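(* There are absolute constants $k_0\in\mathbb N$ and $\alpha,\varepsilon>0$ such that for all integers $d\ge k\ge k_0$ and every $n\ge\alpha d^8k^6$ there is a pair of $k$-ary relational structures $\mathfrak A$ and $\mathfrak B$ with $|V(\mathfrak A)|=|V(\mathfrak B)|=n$ such that some sentence of $\mathsf{FO}^k$ is true in $\mathfrak A$ and false in $\mathfrak B$, but for every sentence $\psi$ of $\mathsf{FO}^d$ or of $\mathsf C^d$ of quantifier rank at most $n^{\varepsilon k}$ we have $\mathfrak A\models\psi$ iff $\mathfrak B\models\psi$.
   Context: $\mathsf{FO}$ is first-order logic over relational vocabularies (atomic formulas $x=y$, $R(x_1,\dots,x_r)$; $\wedge$, $\neg$, $\exists$). $\mathsf C$ extends it by counting quantifiers $\exists^{\ge j}x\,\varphi$. $\mathsf{FO}^k$ and $\mathsf C^k$ are the fragments using at most $k$ distinct variables (variables may be reused). Quantifier rank is the maximal nesting depth of quantifiers (counting quantifiers count as quantifiers). A $k$-ary structure has a finite universe and relations of arity at most $k$. *)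

theory Defs
  imports Complex_Main
begin

text \<open>A relational vocabulary is a partial map sending each of its symbols to its arity.\<close>

type_synonym 'r vocabulary = "'r \<rightharpoonup> nat"

record ('r, 'a) rel_structure =
  univ :: "'a set"
  interp :: "'r \<Rightarrow> 'a list set"

definition kary_vocabulary :: "nat \<Rightarrow> 'r vocabulary \<Rightarrow> bool" where
  "kary_vocabulary k \<tau> \<longleftrightarrow> finite (dom \<tau>) \<and> (\<forall>R r. \<tau> R = Some r \<longrightarrow> 1 \<le> r \<and> r \<le> k)"

text \<open>The value of \<open>interp\<close> on symbols outside the vocabulary is irrelevant.\<close>

definition finite_structure :: "'r vocabulary \<Rightarrow> ('r, 'a) rel_structure \<Rightarrow> bool" where
  "finite_structure \<tau> A \<longleftrightarrow> finite (univ A) \<and> univ A \<noteq> {} \<and>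
     (\<forall>R r. \<tau> R = Some r \<longrightarrow> interp A R \<subseteq> {as. length as = r \<and> set as \<subseteq> univ A})"

definition kary_structure :: "nat \<Rightarrow> 'r vocabulary \<Rightarrow> ('r, 'a) rel_structure \<Rightarrow> bool" where
  "kary_structure k \<tau> A \<longleftrightarrow> kary_vocabulary k \<tau> \<and> finite_structure \<tau> A"

text \<open>Formulas of first-order logic with counting; variables are natural numbers, and
  \<open>CEx j x \<phi>\<close> is the counting quantifier ``at least \<open>j\<close> elements \<open>x\<close> satisfy \<open>\<phi>\<close>''.\<close>

datatype 'r fm =
    Eq nat nat
  | Rel 'r "nat list"
  | Neg "'r fm"
  | Conj "'r fm" "'r fm"
  | Ex nat "'r fm"
  | CEx nat nat "'r fm"

primrec wf_fm :: "'r vocabulary \<Rightarrow> 'r fm \<Rightarrow> bool" where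
  "wf_fm \<tau> (Eq x y) \<longleftrightarrow> True"
| "wf_fm \<tau> (Rel R xs) \<longleftrightarrow> \<tau> R = Some (length xs)"
| "wf_fm \<tau> (Neg \<phi>) \<longleftrightarrow> wf_fm \<tau> \<phi>"
| "wf_fm \<tau> (Conj \<phi> \<psi>) \<longleftrightarrow> wf_fm \<tau> \<phi> \<and> wf_fm \<tau> \<psi>"
| "wf_fm \<tau> (Ex x \<phi>) \<longleftrightarrow> wf_fm \<tau> \<phi>"
| "wf_fm \<tau> (CEx j x \<phi>) \<longleftrightarrow> wf_fm \<tau> \<phi>"

primrec is_FO :: "'r fm \<Rightarrow> bool" where
  "is_FO (Eq x y) \<longleftrightarrow> True"
| "is_FO (Rel R xs) \<longleftrightarrow> True"
| "is_FO (Neg \<phi>) \<longleftrightarrow> is_FO \<phi>"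
| "is_FO (Conj \<phi> \<psi>) \<longleftrightarrow> is_FO \<phi> \<and> is_FO \<psi>"
| "is_FO (Ex x \<phi>) \<longleftrightarrow> is_FO \<phi>"
| "is_FO (CEx j x \<phi>) \<longleftrightarrow> False"

text \<open>All variables of a formula: free, bound, and those occurring only at a quantifier.\<close>

primrec vars :: "'r fm \<Rightarrow> nat set" where
  "vars (Eq x y) = {x, y}"
| "vars (Rel R xs) = set xs"
| "vars (Neg \<phi>) = vars \<phi>"
| "vars (Conj \<phi> \<psi>) = vars \<phi> \<union> vars \<psi>"
| "vars (Ex x \<phi>) = insert x (vars \<phi>)"
| "vars (CEx j x \<phi>) = insert x (vars \<phi>)"

primrec fv :: "'r fm \<Rightarrow> nat set" where
  "fv (Eq x y) = {x, y}"
| "fv (Rel R xs) = set xs"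
| "fv (Neg \<phi>) = fv \<phi>"
| "fv (Conj \<phi> \<psi>) = fv \<phi> \<union> fv \<psi>"
| "fv (Ex x \<phi>) = fv \<phi> - {x}"
| "fv (CEx j x \<phi>) = fv \<phi> - {x}"

primrec qrank :: "'r fm \<Rightarrow> nat" where
  "qrank (Eq x y) = 0"
| "qrank (Rel R xs) = 0"
| "qrank (Neg \<phi>) = qrank \<phi>"
| "qrank (Conj \<phi> \<psi>) = max (qrank \<phi>) (qrank \<psi>)"
| "qrank (Ex x \<phi>) = Suc (qrank \<phi>)"
| "qrank (CEx j x \<phi>) = Suc (qrank \<phi>)"

text \<open>The clause for \<open>CEx\<close> is meaningful for finite universes only, because of \<open>card\<close>.\<close>

primrec sat :: "('r, 'a) rel_structure \<Rightarrow> (nat \<Rightarrow> 'a) \<Rightarrow> 'r fm \<Rightarrow> bool" where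
  "sat A s (Eq x y) \<longleftrightarrow> s x = s y"
| "sat A s (Rel R xs) \<longleftrightarrow> map s xs \<in> interp A R"
| "sat A s (Neg \<phi>) \<longleftrightarrow> \<not> sat A s \<phi>"
| "sat A s (Conj \<phi> \<psi>) \<longleftrightarrow> sat A s \<phi> \<and> sat A s \<psi>"
| "sat A s (Ex x \<phi>) \<longleftrightarrow> (\<exists>a \<in> univ A. sat A (s(x := a)) \<phi>)"
| "sat A s (CEx j x \<phi>) \<longleftrightarrow> j \<le> card {a \<in> univ A. sat A (s(x := a)) \<phi>}"

text \<open>Truth of a sentence. For a sentence over a (nonempty) structure, the choice of the
  assignment does not matter.\<close>

definition models :: "('r, 'a) rel_structure \<Rightarrow> 'r fm \<Rightarrow> bool" where
  "models A \<phi> \<longleftrightarrow> (\<forall>s. range s \<subseteq> univ A \<longrightarrow> sat A s \<phi>)"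

definition C_sentences :: "'r vocabulary \<Rightarrow> nat \<Rightarrow> 'r fm set" where
  "C_sentences \<tau> k = {\<phi>. wf_fm \<tau> \<phi> \<and> fv \<phi> = {} \<and> card (vars \<phi>) \<le> k}"

definition FO_sentences :: "'r vocabulary \<Rightarrow> nat \<Rightarrow> 'r fm set" where
  "FO_sentences \<tau> k = {\<phi>. wf_fm \<tau> \<phi> \<and> is_FO \<phi> \<and> fv \<phi> = {} \<and> card (vars \<phi>) \<le> k}"

end

theory Submission
  imports Defs "HOL-Library.Z2" "HOL-Library.Function_Algebras" "HOL-Library.FuncSet"
    "HOL-Library.Countable"
begin

text \<open>
  The structures encode systems of XOR equations over \<open>n div 2\<close> variables; \<open>\<AA>\<close> and \<open>\<BB>\<close> differ only
  in the right-hand side of one equation. The equations trace a long linear computation in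
  blocks: the state of each block is the image of the state of the previous one under a linear
  bijection of \<open>F\<^sub>2\<^sup>w\<close>, computed by prefix sums so that every equation has at most three terms. The
  initial state is \<open>0\<close>, and the last value is claimed to be \<open>0\<close> or \<open>1\<close>, respectively.
  Evaluating the computation step by step needs three registers only. On the other hand, for
  random bijections no sum of few values before a block coincides with a nonzero sum of few values
  after it, so a player with few pebbles who leaves a block untouched cannot relate the two sides;
  the contradiction can be pushed down by only \<open>d + 1\<close> blocks per round.

  To pack \<open>n\<^bsup>\<Omega>(k)\<^esup>\<close> values into few variables, each value is replaced by the XOR of \<open>\<Theta>(k)\<close>
  variables chosen by a random map (hardness condensation). By unique-neighbour expansion, \<open>d\<close>
  pebbled variables determine linear combinations of at most \<open>d\<close> values.
\<close>

section \<open>Counting\<close>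

lemma union_bound:
  fixes N :: nat
  assumes "finite \<Omega>" "\<Omega> \<noteq> {}" "finite E" "card E < N"
    and bad: "\<And>e. e \<in> E \<Longrightarrow> N * card {x \<in> \<Omega>. P e x} \<le> card \<Omega>"
  shows "\<exists>x\<in>\<Omega>. \<forall>e\<in>E. \<not> P e x"
proof -
  have "N * card (\<Union>e\<in>E. {x \<in> \<Omega>. P e x}) \<le> N * (\<Sum>e\<in>E. card {x \<in> \<Omega>. P e x})"
    using assms(3) by (intro mult_left_mono card_UN_le) auto
  also have "\<dots> = (\<Sum>e\<in>E. N * card {x \<in> \<Omega>. P e x})"
    by (rule sum_distrib_left)
  also have "\<dots> \<le> card E * card \<Omega>"
    using sum_bounded_above[of E "\<lambda>e. N * card {x \<in> \<Omega>. P e x}" "card \<Omega>"] bad by simp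
  also have "\<dots> < N * card \<Omega>"
    using assms by (simp add: card_gt_0_iff)
  finally have "card (\<Union>e\<in>E. {x \<in> \<Omega>. P e x}) < card \<Omega>"
    by simp
  then have "\<not> \<Omega> \<subseteq> (\<Union>e\<in>E. {x \<in> \<Omega>. P e x})"
    using assms(1,3) card_mono[of "\<Union>e\<in>E. {x \<in> \<Omega>. P e x}" \<Omega>] by auto
  then show ?thesis
    by blast
qed

lemma finite_nonempty_subsets:
  "finite X \<Longrightarrow> finite {S. S \<subseteq> X \<and> S \<noteq> {} \<and> card S \<le> l}"
  by (rule finite_subset[of _ "Pow X"]) auto

lemma card_nonempty_subsets_le:
  assumes "finite X"
  shows "card {S. S \<subseteq> X \<and> S \<noteq> {} \<and> card S \<le> l} \<le> card X ^ l"
proof -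
  have "{S. S \<subseteq> X \<and> S \<noteq> {} \<and> card S \<le> l} \<subseteq> set ` {xs. set xs \<subseteq> X \<and> length xs = l}"
  proof
    fix S assume "S \<in> {S. S \<subseteq> X \<and> S \<noteq> {} \<and> card S \<le> l}"
    then obtain a where S: "S \<subseteq> X" "card S \<le> l" "a \<in> S"
      by blast
    obtain ys where ys: "set ys = S" "distinct ys"
      using finite_distinct_list finite_subset[OF S(1) assms] by blast
    have "set (ys @ replicate (l - card S) a) = S"
      using S(3) ys by auto
    moreover have "length (ys @ replicate (l - card S) a) = l"
      using S(2) ys distinct_card by fastforce
    ultimately show "S \<in> set ` {xs. set xs \<subseteq> X \<and> length xs = l}"
      using S(1) by blast
  qed
  then have "card {S. S \<subseteq> X \<and> S \<noteq> {} \<and> card S \<le> l} \<le> card {xs. set xs \<subseteq> X \<and> length xs = l}"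
    by (rule surj_card_le[OF finite_lists_length_eq[OF assms]])
  then show ?thesis
    by (simp add: card_lists_length_eq[OF assms])
qed

lemma card_Collect_PiE_insert_le:
  assumes "finite J" "\<And>i. i \<in> insert k J \<Longrightarrow> finite (G i)"
  shows "card {f \<in> PiE (insert k J) G. P f} \<le> (\<Sum>f\<in>PiE J G. card {y \<in> G k. P (f(k := y))})"
proof -
  let ?S = "\<lambda>f. {y \<in> G k. P (f(k := y))}"
  have fin: "finite (PiE J G)" "finite (G k)"
    using assms by (auto intro!: finite_PiE)
  have "{f \<in> PiE (insert k J) G. P f} \<subseteq> (\<lambda>(f, y). f(k := y)) ` (SIGMA f:PiE J G. ?S f)"
  proof
    fix f assume f: "f \<in> {f \<in> PiE (insert k J) G. P f}"
    then have "f \<in> (\<lambda>(y, f). f(k := y)) ` (G k \<times> PiE J G)"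
      by (simp add: PiE_insert_eq)
    then obtain y f' where "f = f'(k := y)" "y \<in> G k" "f' \<in> PiE J G"
      by auto
    with f show "f \<in> (\<lambda>(f, y). f(k := y)) ` (SIGMA f:PiE J G. ?S f)"
      by (intro image_eqI[of _ _ "(f', y)"]) simp_all
  qed
  then have "card {f \<in> PiE (insert k J) G. P f} \<le> card (SIGMA f:PiE J G. ?S f)"
    using fin by (intro surj_card_le[OF finite_SigmaI]) simp_all
  also have "\<dots> = (\<Sum>f\<in>PiE J G. card (?S f))"
    using fin by (simp add: card_SigmaI)
  finally show ?thesis .
qed

text \<open>If an event has probability at most \<open>1 / N\<close> conditioned on all coordinates but \<open>k\<close>, then
  also unconditionally.\<close>

lemma card_PiE_fibres_le:
  fixes N :: nat
  assumes "finite I" "k \<in> I" "\<And>i. i \<in> I \<Longrightarrow> finite (G i)"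
    and fibre: "\<And>f. f \<in> PiE I G \<Longrightarrow> N * card {y \<in> G k. P (f(k := y))} \<le> card (G k)"
  shows "N * card {f \<in> PiE I G. P f} \<le> card (PiE I G)"
proof -
  let ?J = "I - {k}"
  have I: "insert k ?J = I"
    using assms(2) by blast
  have "card {f \<in> PiE I G. P f} \<le> (\<Sum>f\<in>PiE ?J G. card {y \<in> G k. P (f(k := y))})"
    using card_Collect_PiE_insert_le[of ?J k G P] assms(1,3) unfolding I by simp
  then have "N * card {f \<in> PiE I G. P f} \<le> (\<Sum>f\<in>PiE ?J G. N * card {y \<in> G k. P (f(k := y))})"
    unfolding sum_distrib_left[symmetric] by (rule mult_le_mono2)
  also have "\<dots> \<le> (\<Sum>f\<in>PiE ?J G. card (G k))"
  proof (rule sum_mono)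
    fix f assume f: "f \<in> PiE ?J G"
    show "N * card {y \<in> G k. P (f(k := y))} \<le> card (G k)"
    proof (cases "G k = {}")
      case False
      then obtain z where "z \<in> G k"
        by blast
      then have "f(k := z) \<in> PiE I G"
        using PiE_fun_upd[of z G k f ?J] f unfolding I by blast
      then show ?thesis
        using fibre[of "f(k := z)"] by simp
    qed simp
  qed
  also have "\<dots> = card (PiE (insert k ?J) G)"
    using assms(1) by (simp add: card_PiE mult.commute del: insert_Diff_single)
  finally show ?thesis
    unfolding I .
qed

section \<open>Unique-neighbour expanders\<close>

text \<open>A map \<open>\<gamma> :: 'a \<Rightarrow> nat \<Rightarrow> 'b\<close> is the bipartite multigraph of degree \<open>D\<close> in which the edges at
  \<open>u\<close> lead to \<open>\<gamma> u 0, \<dots>, \<gamma> u (D - 1)\<close>.\<close>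

definition edges_to :: "('a \<Rightarrow> nat \<Rightarrow> 'b) \<Rightarrow> nat \<Rightarrow> 'a set \<Rightarrow> 'b \<Rightarrow> ('a \<times> nat) set" where
  "edges_to \<gamma> D A v = {(u, i) \<in> A \<times> {..<D}. \<gamma> u i = v}"

definition nbrs :: "('a \<Rightarrow> nat \<Rightarrow> 'b) \<Rightarrow> nat \<Rightarrow> 'a set \<Rightarrow> 'b set" where
  "nbrs \<gamma> D A = (\<Union>u\<in>A. \<gamma> u ` {..<D})"

definition unique_nbrs :: "('a \<Rightarrow> nat \<Rightarrow> 'b) \<Rightarrow> nat \<Rightarrow> 'a set \<Rightarrow> 'b set" where
  "unique_nbrs \<gamma> D A = {v. card (edges_to \<gamma> D A v) = 1}"

definition unique_nbr_expander :: "('a \<Rightarrow> nat \<Rightarrow> 'b) \<Rightarrow> nat \<Rightarrow> 'a set \<Rightarrow> nat \<Rightarrow> bool" where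
  "unique_nbr_expander \<gamma> D U s \<longleftrightarrow>
     (\<forall>A\<subseteq>U. card A \<le> s \<longrightarrow> card A \<le> card (unique_nbrs \<gamma> D A))"

lemma finite_edges_to: "finite A \<Longrightarrow> finite (edges_to \<gamma> D A v)"
  by (rule finite_subset[of _ "A \<times> {..<D}"]) (auto simp: edges_to_def)

lemma edges_to_empty_iff: "edges_to \<gamma> D A v = {} \<longleftrightarrow> v \<notin> nbrs \<gamma> D A"
  by (auto simp: edges_to_def nbrs_def)

lemma finite_nbrs: "finite A \<Longrightarrow> finite (nbrs \<gamma> D A)"
  by (simp add: nbrs_def)

lemma unique_nbrs_subset_nbrs: "unique_nbrs \<gamma> D A \<subseteq> nbrs \<gamma> D A"
proof
  fix v assume "v \<in> unique_nbrs \<gamma> D A"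
  then have "edges_to \<gamma> D A v \<noteq> {}"
    by (auto simp: unique_nbrs_def)
  then show "v \<in> nbrs \<gamma> D A"
    by (simp add: edges_to_empty_iff)
qed

lemma sum_card_edges_to:
  assumes "finite A"
  shows "(\<Sum>v\<in>nbrs \<gamma> D A. card (edges_to \<gamma> D A v)) = D * card A"
proof -
  have "(\<Sum>v\<in>nbrs \<gamma> D A. card (edges_to \<gamma> D A v)) = card (\<Union>v\<in>nbrs \<gamma> D A. edges_to \<gamma> D A v)"
    using assms finite_edges_to[OF assms]
    by (intro card_UN_disjoint[symmetric]) (auto simp: finite_nbrs edges_to_def)
  also have "(\<Union>v\<in>nbrs \<gamma> D A. edges_to \<gamma> D A v) = A \<times> {..<D}"
    by (auto simp: edges_to_def nbrs_def)
  finally show ?thesis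
    by (simp add: card_cartesian_product mult.commute)
qed

lemma double_card_nbrs_le:
  assumes "finite A"
  shows "2 * card (nbrs \<gamma> D A) \<le> D * card A + card (unique_nbrs \<gamma> D A)"
proof -
  have fin: "finite (nbrs \<gamma> D A)"
    using assms by (rule finite_nbrs)
  have "2 * card (nbrs \<gamma> D A) = (\<Sum>v\<in>nbrs \<gamma> D A. 2)"
    by simp
  also have "\<dots> \<le> (\<Sum>v\<in>nbrs \<gamma> D A. card (edges_to \<gamma> D A v) + of_bool (v \<in> unique_nbrs \<gamma> D A))"
  proof (rule sum_mono)
    fix v assume "v \<in> nbrs \<gamma> D A"
    then have "card (edges_to \<gamma> D A v) \<noteq> 0"
      using finite_edges_to[OF assms, of \<gamma> D v] edges_to_empty_iff[of \<gamma> D A v] by simp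
    then show "2 \<le> card (edges_to \<gamma> D A v) + of_bool (v \<in> unique_nbrs \<gamma> D A)"
      by (cases "card (edges_to \<gamma> D A v) = 1") (auto simp: unique_nbrs_def)
  qed
  also have "\<dots> = D * card A + card (nbrs \<gamma> D A \<inter> unique_nbrs \<gamma> D A)"
    using fin by (simp add: sum.distrib sum_card_edges_to[OF assms] sum_of_bool_eq)
  also have "nbrs \<gamma> D A \<inter> unique_nbrs \<gamma> D A = unique_nbrs \<gamma> D A"
    using unique_nbrs_subset_nbrs by (rule Int_absorb1)
  finally show ?thesis .
qed

lemma unique_nbr_expander_if_card_nbrs:
  assumes "finite U" "1 \<le> e"
    and "\<And>A. A \<subseteq> U \<Longrightarrow> A \<noteq> {} \<Longrightarrow> card A \<le> s \<Longrightarrow> 2 * e * card A \<le> card (nbrs \<gamma> (3 * e) A)"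
  shows "unique_nbr_expander \<gamma> (3 * e) U s"
  unfolding unique_nbr_expander_def
proof (intro allI impI)
  fix A assume A: "A \<subseteq> U" "card A \<le> s"
  show "card A \<le> card (unique_nbrs \<gamma> (3 * e) A)"
  proof (cases "A = {}")
    case False
    have "2 * (2 * e * card A) \<le> 3 * e * card A + card (unique_nbrs \<gamma> (3 * e) A)"
      using assms(3)[OF A(1) False A(2)]
        double_card_nbrs_le[OF finite_subset[OF A(1) assms(1)], of \<gamma> "3 * e"] by linarith
    then have "e * card A \<le> card (unique_nbrs \<gamma> (3 * e) A)"
      by (simp add: mult.assoc)
    moreover have "1 * card A \<le> e * card A"
      using assms(2) by (rule mult_le_mono1)
    ultimately show ?thesis
      by linarith
  qed simp
qed

lemma card_PiE_two_ranges:
  assumes "finite U" "A \<subseteq> U"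
  shows "card (PiE (U \<times> {..<D}) (\<lambda>p. if fst p \<in> A then Z else V))
    = card Z ^ (D * card A) * card V ^ (D * (card U - card A))"
proof -
  have "finite A"
    using assms finite_subset by blast
  have "(\<Prod>p\<in>U \<times> {..<D}. card (if fst p \<in> A then Z else V))
      = (\<Prod>u\<in>U. card (if u \<in> A then Z else V) ^ D)"
    using prod.cartesian_product[of "\<lambda>u i. card (if u \<in> A then Z else V)" "{..<D}" U]
    by (simp add: split_def)
  also have "\<dots> = (\<Prod>u\<in>U - A. card (if u \<in> A then Z else V) ^ D) *
      (\<Prod>u\<in>A. card (if u \<in> A then Z else V) ^ D)"
    by (rule prod.subset_diff[OF assms(2,1)])
  also have "\<dots> = (\<Prod>u\<in>U - A. card V ^ D) * (\<Prod>u\<in>A. card Z ^ D)"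
    by (intro arg_cong2[where f = "(*)"] prod.cong) auto
  also have "\<dots> = card Z ^ (D * card A) * card V ^ (D * (card U - card A))"
    using \<open>finite A\<close> assms(2) by (simp add: power_mult card_Diff_subset)
  finally show ?thesis
    using assms(1) by (simp add: card_PiE)
qed

definition has_few_nbrs :: "('a \<Rightarrow> nat \<Rightarrow> 'b) \<Rightarrow> nat \<Rightarrow> 'a set \<Rightarrow> nat \<Rightarrow> nat \<Rightarrow> bool" where
  "has_few_nbrs \<gamma> D U a l \<longleftrightarrow>
     (\<exists>A\<subseteq>U. card A = a \<and> nbrs \<gamma> D A \<noteq> {} \<and> card (nbrs \<gamma> D A) \<le> l)"

lemma maps_with_few_nbrs_subset:
  "{f \<in> (U \<times> {..<D}) \<rightarrow>\<^sub>E V. has_few_nbrs (curry f) D U a l}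
    \<subseteq> (\<Union>(A, Z)\<in>{A. A \<subseteq> U \<and> card A = a} \<times> {Z. Z \<subseteq> V \<and> Z \<noteq> {} \<and> card Z \<le> l}.
         PiE (U \<times> {..<D}) (\<lambda>p. if fst p \<in> A then Z else V))" (is "?Few \<subseteq> ?Union")
proof
  fix f assume "f \<in> ?Few"
  then obtain A where f: "f \<in> (U \<times> {..<D}) \<rightarrow>\<^sub>E V" and A: "A \<subseteq> U" "card A = a"
    "nbrs (curry f) D A \<noteq> {}" "card (nbrs (curry f) D A) \<le> l"
    by (auto simp: has_few_nbrs_def)
  have "nbrs (curry f) D A \<subseteq> V"
    using f A(1) by (auto simp: nbrs_def)
  moreover have "f \<in> PiE (U \<times> {..<D}) (\<lambda>p. if fst p \<in> A then nbrs (curry f) D A else V)"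
    using f by (auto simp: nbrs_def PiE_iff)
  ultimately show "f \<in> ?Union"
    using A by (intro UN_I[of "(A, nbrs (curry f) D A)"]) simp_all
qed

lemma card_maps_with_few_nbrs_le:
  assumes "finite U" "finite V" "a \<le> card U"
  shows "card {f \<in> (U \<times> {..<D}) \<rightarrow>\<^sub>E V. has_few_nbrs (curry f) D U a l}
    \<le> card U ^ a * card V ^ l * (l ^ (D * a) * card V ^ (D * (card U - a)))"
proof -
  define F where "F A Z = PiE (U \<times> {..<D}) (\<lambda>p. if fst p \<in> A then Z else V)" for A Z
  define As where "As = {A. A \<subseteq> U \<and> card A = a}"
  define Zs where "Zs = {Z. Z \<subseteq> V \<and> Z \<noteq> {} \<and> card Z \<le> l}"
  have As: "finite As" "card As \<le> card U ^ a"
    using n_subsets[OF assms(1), of a] binomial_le_pow[OF assms(3)] assms(1)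
    by (simp_all add: As_def)
  have Zs: "finite Zs" "card Zs \<le> card V ^ l"
    unfolding Zs_def using finite_nonempty_subsets card_nonempty_subsets_le assms(2) by blast+
  have "finite (F A Z)" if "(A, Z) \<in> As \<times> Zs" for A Z
  proof -
    have "finite Z"
      using that assms(2) by (auto simp: Zs_def intro: finite_subset)
    then show ?thesis
      unfolding F_def using assms(1,2) by (intro finite_PiE) auto
  qed
  then have "card {f \<in> (U \<times> {..<D}) \<rightarrow>\<^sub>E V. has_few_nbrs (curry f) D U a l}
      \<le> card (\<Union>(A, Z)\<in>As \<times> Zs. F A Z)"
    using As Zs maps_with_few_nbrs_subset[of U D V a l]
    by (intro card_mono finite_UN_I) (auto simp: F_def As_def Zs_def)
  also have "\<dots> \<le> (\<Sum>(A, Z)\<in>As \<times> Zs. card (F A Z))"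
    using card_UN_le[of "As \<times> Zs" "\<lambda>(A, Z). F A Z"] As Zs by (simp add: split_def)
  also have "\<dots> \<le> card (As \<times> Zs) * (l ^ (D * a) * card V ^ (D * (card U - a)))"
    using assms(1)
    by (intro sum_bounded_above[where 'a = nat, simplified])
      (auto simp: F_def As_def Zs_def card_PiE_two_ranges power_mono)
  also have "card (As \<times> Zs) \<le> card U ^ a * card V ^ l"
    using As(2) Zs(2) by (simp add: card_cartesian_product mult_le_mono)
  finally show ?thesis
    by simp
qed

lemma few_nbrs_improbable:
  assumes "finite U" "finite V" "1 \<le> a" "a \<le> s" "a \<le> card U"
    and bound: "Suc s * card U * (2 * e * s) ^ (3 * e) \<le> card V ^ e"
  shows "Suc s * card {f \<in> (U \<times> {..<3 * e}) \<rightarrow>\<^sub>E V. has_few_nbrs (curry f) (3 * e) U a (2 * e * a)}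
    \<le> card ((U \<times> {..<3 * e}) \<rightarrow>\<^sub>E V)"
proof -
  let ?D = "3 * e" and ?m = "card V" and ?M = "card U"
  let ?rest = "?m ^ (?D * (?M - a))"
  have "Suc s * card {f \<in> (U \<times> {..<?D}) \<rightarrow>\<^sub>E V. has_few_nbrs (curry f) ?D U a (2 * e * a)}
      \<le> Suc s ^ a * (?M ^ a * ?m ^ (2 * e * a) * ((2 * e * s) ^ (?D * a) * ?rest))"
  proof (rule mult_le_mono)
    show "Suc s \<le> Suc s ^ a"
      using assms(3) by (intro self_le_power) auto
    show "card {f \<in> (U \<times> {..<?D}) \<rightarrow>\<^sub>E V. has_few_nbrs (curry f) ?D U a (2 * e * a)}
        \<le> ?M ^ a * ?m ^ (2 * e * a) * ((2 * e * s) ^ (?D * a) * ?rest)"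
      using card_maps_with_few_nbrs_le[OF assms(1,2,5)]
      by (rule order_trans) (intro mult_le_mono power_mono order_refl assms(4) zero_le)
  qed
  also have "\<dots> = (Suc s * ?M * (2 * e * s) ^ ?D) ^ a * ?m ^ (2 * e * a) * ?rest"
    unfolding power_mult[of "2 * e * s" ?D] by (simp only: power_mult_distrib mult_ac)
  also have "\<dots> \<le> (?m ^ e) ^ a * ?m ^ (2 * e * a) * ?rest"
    using bound by (intro mult_right_mono power_mono) auto
  also have "\<dots> = ?m ^ (e * a + 2 * e * a + ?D * (?M - a))"
    by (simp only: power_add power_mult)
  also have "e * a + 2 * e * a + ?D * (?M - a) = ?D * ?M"
    using assms(5) by (simp add: algebra_simps diff_mult_distrib2)
  also have "?m ^ (?D * ?M) = card ((U \<times> {..<?D}) \<rightarrow>\<^sub>E V)"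
    using assms(1) by (simp add: card_funcsetE card_cartesian_product mult.commute)
  finally show ?thesis .
qed

lemma unique_nbr_expander_exists:
  assumes "finite U" "finite V" "1 \<le> e" "V \<noteq> {}"
    and bound: "Suc s * card U * (2 * e * s) ^ (3 * e) \<le> card V ^ e"
  obtains \<gamma> where "\<And>u i. u \<in> U \<Longrightarrow> i < 3 * e \<Longrightarrow> \<gamma> u i \<in> V" "unique_nbr_expander \<gamma> (3 * e) U s"
proof -
  let ?\<Omega> = "(U \<times> {..<3 * e}) \<rightarrow>\<^sub>E V"
  let ?few_nbrs = "\<lambda>a f. has_few_nbrs (curry f) (3 * e) U a (2 * e * a)"
  let ?sizes = "{1..min s (card U)}"
  have "finite ?\<Omega>" "?\<Omega> \<noteq> {}"
    using assms by (auto intro!: finite_PiE simp: PiE_eq_empty_iff)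
  moreover have "card ?sizes < Suc s"
    by simp
  ultimately have "\<exists>f\<in>?\<Omega>. \<forall>a\<in>?sizes. \<not> ?few_nbrs a f"
    using few_nbrs_improbable[OF assms(1,2) _ _ _ bound] by (intro union_bound) auto
  then obtain f where f: "f \<in> ?\<Omega>" and many: "\<And>a. a \<in> ?sizes \<Longrightarrow> \<not> ?few_nbrs a f"
    by blast
  show thesis
  proof
    show "curry f u i \<in> V" if "u \<in> U" "i < 3 * e" for u i
      using f that by auto
    show "unique_nbr_expander (curry f) (3 * e) U s"
    proof (rule unique_nbr_expander_if_card_nbrs[OF assms(1,3)])
      fix A assume A: "A \<subseteq> U" "A \<noteq> {}" "card A \<le> s"
      have "1 \<le> card A" "card A \<le> card U"
        using A assms(1) by (auto simp: Suc_le_eq card_gt_0_iff intro: card_mono finite_subset)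
      moreover have "nbrs (curry f) (3 * e) A \<noteq> {}"
        using A(2) assms(3) by (auto simp: nbrs_def lessThan_empty_iff)
      ultimately show "2 * e * card A \<le> card (nbrs (curry f) (3 * e) A)"
        using many[of "card A"] A by (auto simp: has_few_nbrs_def)
    qed
  qed
qed

section \<open>Linear maps over the two-element field\<close>

class char_2 = ab_group_add +
  assumes add_self [simp]: "x + x = 0"

instance bit :: char_2
  by standard simp

instance "fun" :: (type, char_2) char_2
  by standard (simp add: fun_eq_iff)

lemma add_add_self [simp]:
  fixes x :: "'a::char_2"
  shows "x + (x + y) = y"
  by (simp flip: add.assoc)

lemma add_eq_iff_char_2:
  fixes x :: "'a::char_2"
  shows "x + y = z \<longleftrightarrow> x = y + z"
  by (metis add.commute add_add_self)

lemma sum_sym_diff_char_2: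
  fixes f :: "'b \<Rightarrow> 'a::char_2"
  assumes "finite A" "finite B"
  shows "sum f (sym_diff A B) = sum f A + sum f B"
proof -
  have "sum f A + sum f B = (sum f (A \<inter> B) + sum f (A - B)) + (sum f (A \<inter> B) + sum f (B - A))"
    using sum.Int_Diff[OF assms(1), of f B] sum.Int_Diff[OF assms(2), of f A]
    by (simp add: Int_commute)
  also have "\<dots> = sum f (A - B) + sum f (B - A)"
    by (simp add: add_ac)
  also have "\<dots> = sum f (sym_diff A B)"
    using assms by (intro sum.union_disjoint[symmetric]) auto
  finally show ?thesis ..
qed

type_synonym bitvec = "nat \<Rightarrow> bit"

definition vecs :: "nat \<Rightarrow> bitvec set" where
  "vecs w = {z. \<forall>c\<ge>w. z c = 0}"

definition unitv :: "nat \<Rightarrow> bitvec" where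
  "unitv i = (\<lambda>c. of_bool (c = i))"

definition trunc :: "nat \<Rightarrow> bitvec \<Rightarrow> bitvec" where
  "trunc j z = (\<lambda>c. if c < j then z c else 0)"

lemma zero_in_vecs [simp]: "0 \<in> vecs w"
  by (simp add: vecs_def)

lemma add_in_vecs: "x \<in> vecs w \<Longrightarrow> y \<in> vecs w \<Longrightarrow> x + y \<in> vecs w"
  by (simp add: vecs_def)

lemma sum_in_vecs: "(\<And>u. u \<in> A \<Longrightarrow> f u \<in> vecs w) \<Longrightarrow> sum f A \<in> vecs w"
  by (induction A rule: infinite_finite_induct) (simp_all add: add_in_vecs)

lemma unitv_in_vecs: "i < w \<Longrightarrow> unitv i \<in> vecs w"
  by (auto simp: vecs_def unitv_def)

lemma unitv_nonzero [simp]: "unitv i \<noteq> 0"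
  by (auto simp: unitv_def fun_eq_iff)

lemma trunc_in_vecs: "z \<in> vecs w \<Longrightarrow> trunc j z \<in> vecs w"
  by (auto simp: vecs_def trunc_def)

lemma trunc_0 [simp]: "trunc 0 z = 0"
  by (simp add: trunc_def fun_eq_iff)

lemma trunc_eq_self: "z \<in> vecs w \<Longrightarrow> trunc w z = z"
  by (auto simp: trunc_def vecs_def fun_eq_iff)

lemma trunc_Suc: "trunc (Suc j) z = trunc j z + (if z j = 1 then unitv j else 0)"
  by (rule ext) (auto simp: trunc_def unitv_def less_Suc_eq)

lemma bij_betw_Pow_vecs: "bij_betw (\<lambda>S c. of_bool (c \<in> S)) (Pow {..<w}) (vecs w)"
proof (rule bij_betwI[where g = "\<lambda>z. {c. z c = 1}"])
  show "(\<lambda>S c. of_bool (c \<in> S)) \<in> Pow {..<w} \<rightarrow> vecs w"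
    by (auto simp: vecs_def)
  show "(\<lambda>z. {c. z c = 1}) \<in> vecs w \<rightarrow> Pow {..<w}"
    by (force simp: vecs_def not_le[symmetric])
  show "{c. of_bool (c \<in> S) = (1::bit)} = S" for S :: "nat set"
    by auto
  show "(\<lambda>c. of_bool (c \<in> {c. z c = 1})) = z" for z :: bitvec
    by (rule ext) auto
qed

lemma finite_vecs: "finite (vecs w)"
  using bij_betw_finite[OF bij_betw_Pow_vecs] by simp

lemma card_vecs: "card (vecs w) = 2 ^ w"
  using bij_betw_same_card[OF bij_betw_Pow_vecs, of w] by (simp add: card_Pow)

text \<open>Over the two-element field, linear means additive.\<close>

definition inj_linear :: "nat \<Rightarrow> (bitvec \<Rightarrow> bitvec) \<Rightarrow> bool" where
  "inj_linear w \<tau> \<longleftrightarrow> \<tau> \<in> vecs w \<rightarrow> vecs w \<and> inj_on \<tau> (vecs w) \<and>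
     (\<forall>x\<in>vecs w. \<forall>y\<in>vecs w. \<tau> (x + y) = \<tau> x + \<tau> y)"

lemma inj_linear_in_vecs: "inj_linear w \<tau> \<Longrightarrow> x \<in> vecs w \<Longrightarrow> \<tau> x \<in> vecs w"
  by (auto simp: inj_linear_def)

lemma inj_linear_add:
  "inj_linear w \<tau> \<Longrightarrow> x \<in> vecs w \<Longrightarrow> y \<in> vecs w \<Longrightarrow> \<tau> (x + y) = \<tau> x + \<tau> y"
  by (simp add: inj_linear_def)

lemma inj_linear_0: "inj_linear w \<tau> \<Longrightarrow> \<tau> 0 = 0"
  using inj_linear_add[of w \<tau> 0 0] by simp

lemma inj_linear_eq_iff:
  "inj_linear w \<tau> \<Longrightarrow> x \<in> vecs w \<Longrightarrow> y \<in> vecs w \<Longrightarrow> \<tau> x = \<tau> y \<longleftrightarrow> x = y"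
  by (auto simp: inj_linear_def inj_on_eq_iff)

lemma inj_linear_eq_0_iff: "inj_linear w \<tau> \<Longrightarrow> x \<in> vecs w \<Longrightarrow> \<tau> x = 0 \<longleftrightarrow> x = 0"
  using inj_linear_eq_iff[of w \<tau> x 0] inj_linear_0[of w \<tau>] by simp

lemma inj_linear_sum:
  assumes "inj_linear w \<tau>" "\<And>u. u \<in> A \<Longrightarrow> f u \<in> vecs w"
  shows "\<tau> (sum f A) = (\<Sum>u\<in>A. \<tau> (f u))"
  using assms(2)
  by (induction A rule: infinite_finite_induct)
    (simp_all add: inj_linear_0[OF assms(1)] inj_linear_add[OF assms(1)] sum_in_vecs)

lemma inj_linear_id: "inj_linear w id"
  by (simp add: inj_linear_def)

lemma inj_linear_comp: "inj_linear w \<sigma> \<Longrightarrow> inj_linear w \<tau> \<Longrightarrow> inj_linear w (\<sigma> \<circ> \<tau>)"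
  unfolding inj_linear_def by (auto simp: Pi_iff intro: comp_inj_on inj_on_subset)

lemma inj_linear_if_involution:
  assumes "\<tau> \<in> vecs w \<rightarrow> vecs w" "\<And>z. \<tau> (\<tau> z) = z" "\<And>x y. \<tau> (x + y) = \<tau> x + \<tau> y"
  shows "inj_linear w \<tau>"
proof -
  have "inj_on \<tau> (vecs w)"
    using assms(2) by (metis inj_onI)
  then show ?thesis
    using assms(1,3) by (simp add: inj_linear_def)
qed

lemma additive_form_exists:
  fixes x y :: bitvec
  assumes "x \<noteq> 0" "y \<noteq> 0"
  obtains \<phi> :: "bitvec \<Rightarrow> bit" where "\<And>z z'. \<phi> (z + z') = \<phi> z + \<phi> z'" "\<phi> x = 1" "\<phi> y = 1"
proof -
  obtain a b where a: "x a = 1" and b: "y b = 1"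
    using assms by (auto simp: fun_eq_iff)
  consider "y a = 1" | "x b = 1" | "y a = 0" "x b = 0"
    by (cases "y a"; cases "x b") auto
  then show thesis
  proof cases
    case 1
    then show thesis using that[of "\<lambda>z. z a"] a by simp
  next
    case 2
    then show thesis using that[of "\<lambda>z. z b"] b by simp
  next
    case 3
    then show thesis using that[of "\<lambda>z. z a + z b"] a b by (simp add: add_ac del: add_bit_eq_xor)
  qed
qed

text \<open>The witness is the transvection \<open>z \<mapsto> z + \<phi>(z) (x + y)\<close> for a linear form \<open>\<phi>\<close> with
  \<open>\<phi>(x) = \<phi>(y) = 1\<close>.\<close>

lemma inj_linear_transitive:
  assumes "x \<in> vecs w" "y \<in> vecs w" "x \<noteq> 0" "y \<noteq> 0"
  obtains \<tau> where "inj_linear w \<tau>" "\<tau> x = y"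
proof -
  obtain \<phi> :: "bitvec \<Rightarrow> bit"
    where add: "\<And>z z'. \<phi> (z + z') = \<phi> z + \<phi> z'" and one: "\<phi> x = 1" "\<phi> y = 1"
    using additive_form_exists[OF assms(3,4)] by blast
  define \<tau> where "\<tau> z = z + (if \<phi> z = 1 then x + y else 0)" for z
  have "\<phi> (x + y) = 0" "\<phi> 0 = 0"
    using add[of x y] add[of 0 0] one by simp_all
  then have "\<tau> (\<tau> z) = z" for z
    by (simp add: \<tau>_def add add.assoc)
  moreover have "\<tau> (z + z') = \<tau> z + \<tau> z'" for z z'
    by (cases "\<phi> z"; cases "\<phi> z'") (simp_all add: \<tau>_def add add_ac)
  moreover have "\<tau> \<in> vecs w \<rightarrow> vecs w"
    using assms(1,2) by (simp add: \<tau>_def add_in_vecs)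
  ultimately have "inj_linear w \<tau>"
    by (intro inj_linear_if_involution)
  moreover have "\<tau> x = y"
    using one by (simp add: \<tau>_def)
  ultimately show thesis
    by (rule that)
qed

definition GL :: "nat \<Rightarrow> (bitvec \<Rightarrow> bitvec) set" where
  "GL w = {\<tau> \<in> extensional (vecs w). inj_linear w \<tau>}"

lemma GL_inj_linear: "\<tau> \<in> GL w \<Longrightarrow> inj_linear w \<tau>"
  by (simp add: GL_def)

lemma finite_GL: "finite (GL w)"
proof (rule finite_subset)
  show "GL w \<subseteq> vecs w \<rightarrow>\<^sub>E vecs w"
    by (auto simp: GL_def inj_linear_def PiE_def)
qed (simp add: finite_PiE finite_vecs)

lemma restrict_in_GL: "inj_linear w \<tau> \<Longrightarrow> restrict \<tau> (vecs w) \<in> GL w"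
  by (simp add: GL_def inj_linear_def Pi_iff inj_on_restrict_eq add_in_vecs)

lemma GL_nonempty: "GL w \<noteq> {}"
  using restrict_in_GL[OF inj_linear_id] by blast

text \<open>Composition with a map that sends \<open>y\<close> to \<open>z\<close> shows that all images of \<open>x\<close> are equally
  likely.\<close>

lemma card_GL_fibre_mono:
  assumes "x \<in> vecs w" "y \<in> vecs w - {0}" "z \<in> vecs w - {0}"
  shows "card {\<tau> \<in> GL w. \<tau> x = y} \<le> card {\<tau> \<in> GL w. \<tau> x = z}"
proof -
  obtain \<sigma> where \<sigma>: "inj_linear w \<sigma>" "\<sigma> y = z"
    using inj_linear_transitive[of y w z] assms(2,3) by blast
  let ?h = "\<lambda>\<tau>. restrict (\<sigma> \<circ> \<tau>) (vecs w)"
  have "inj_on ?h (GL w)"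
  proof (rule inj_onI)
    fix \<tau> \<tau>' assume \<tau>: "\<tau> \<in> GL w" "\<tau>' \<in> GL w" "?h \<tau> = ?h \<tau>'"
    have "\<tau> v = \<tau>' v" if "v \<in> vecs w" for v
      using fun_cong[OF \<tau>(3), of v] that \<tau>(1,2)
      by (simp add: inj_linear_eq_iff[OF \<sigma>(1)] inj_linear_in_vecs GL_inj_linear)
    then show "\<tau> = \<tau>'"
      using \<tau>(1,2) by (intro extensionalityI[of _ "vecs w"]) (auto simp: GL_def)
  qed
  moreover have "?h ` {\<tau> \<in> GL w. \<tau> x = y} \<subseteq> {\<tau> \<in> GL w. \<tau> x = z}"
    using \<sigma> assms(1) by (auto intro!: restrict_in_GL inj_linear_comp dest: GL_inj_linear)
  ultimately show ?thesis
    by (intro card_inj_on_le[of ?h]) (auto simp: finite_GL intro: inj_on_subset)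
qed

lemma card_GL_fibre_le:
  assumes "x \<in> vecs w" "x \<noteq> 0"
  shows "(2 ^ w - 1) * card {\<tau> \<in> GL w. \<tau> x = y} \<le> card (GL w)"
proof (cases "y \<in> vecs w - {0}")
  case True
  have "(\<Sum>z\<in>vecs w - {0}. card {\<tau> \<in> GL w. \<tau> x = y})
      \<le> (\<Sum>z\<in>vecs w - {0}. card {\<tau> \<in> GL w. \<tau> x = z})"
    using assms(1) True by (intro sum_mono card_GL_fibre_mono)
  also have "\<dots> = card (\<Union>z\<in>vecs w - {0}. {\<tau> \<in> GL w. \<tau> x = z})"
    by (intro card_UN_disjoint[symmetric]) (auto simp: finite_vecs finite_GL)
  also have "\<dots> \<le> card (GL w)"
    by (intro card_mono finite_GL) auto
  finally show ?thesis
    by (simp add: card_Diff_singleton card_vecs finite_vecs)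
next
  case False
  have "\<tau> x \<in> vecs w - {0}" if "\<tau> \<in> GL w" for \<tau>
    using that assms inj_linear_in_vecs inj_linear_eq_0_iff GL_inj_linear by blast
  then have "{\<tau> \<in> GL w. \<tau> x = y} = {}"
    using False by blast
  then show ?thesis
    by (simp only: card.empty mult_0_right zero_le)
qed

section \<open>The linear computation\<close>

text \<open>The computation consists of \<open>h\<close> blocks of \<open>w \<times> w\<close> values. Column \<open>w - 1\<close> of a block holds a
  state in \<open>F\<^sub>2\<^sup>w\<close>, and the value at \<open>(Suc t, i, j)\<close> is the sum of the first \<open>Suc j\<close> terms in the
  product of row \<open>i\<close> of a matrix with the state of block \<open>t\<close>; this row is \<open>T t (unitv i)\<close>, so that
  \<open>T t\<close> is the transposed matrix. \<open>form_from T g u\<close> expresses value \<open>u\<close> as a linear form in the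
  state of block \<open>g\<close>, provided that \<open>u\<close> lies above block \<open>g\<close> or \<open>g = 0\<close>.\<close>

type_synonym cell = "nat \<times> nat \<times> nat"

primrec comp_from :: "(nat \<Rightarrow> 'a \<Rightarrow> 'a) \<Rightarrow> nat \<Rightarrow> nat \<Rightarrow> 'a \<Rightarrow> 'a" where
  "comp_from T g 0 = id"
| "comp_from T g (Suc n) = comp_from T g n \<circ> T (g + n)"

fun form_from :: "(nat \<Rightarrow> bitvec \<Rightarrow> bitvec) \<Rightarrow> nat \<Rightarrow> cell \<Rightarrow> bitvec" where
  "form_from T g (0, i, j) = unitv i"
| "form_from T g (Suc t, i, j) = comp_from T g (t - g) (trunc (Suc j) (T t (unitv i)))"

fun preds_of :: "(nat \<Rightarrow> bitvec \<Rightarrow> bitvec) \<Rightarrow> nat \<Rightarrow> cell \<Rightarrow> cell list" where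
  "preds_of T w (0, i, j) = []"
| "preds_of T w (Suc t, i, j) =
     (if j = 0 then [] else [(Suc t, i, j - 1)]) @
     (if T t (unitv i) j = 1 then [(t, j, w - 1)] else [])"

definition cells :: "nat \<Rightarrow> nat \<Rightarrow> cell set" where
  "cells h w = {..<h} \<times> {..<w} \<times> {..<w}"

lemma finite_cells: "finite (cells h w)"
  by (simp add: cells_def)

lemma card_cells: "card (cells h w) = h * w ^ 2"
  by (simp add: cells_def card_cartesian_product power2_eq_square)

definition depth_of :: "nat \<Rightarrow> cell \<Rightarrow> nat" where
  "depth_of w = (\<lambda>(t, i, j). t * w + j)"

lemma in_set_preds_ofD:
  assumes "u \<in> cells h w" "p \<in> set (preds_of T w u)"
  shows "p \<in> cells h w" "depth_of w p < depth_of w u" "fst p = fst u \<or> Suc (fst p) = fst u"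
proof -
  obtain t i j where u: "u = (Suc t, i, j)" "Suc t < h" "i < w" "j < w"
    using assms by (cases u; cases "fst u") (auto simp: cells_def)
  consider "p = (Suc t, i, j - 1)" "j \<noteq> 0" | "p = (t, j, w - 1)"
    using assms(2) u(1) by (auto split: if_splits)
  then have "p \<in> cells h w \<and> depth_of w p < depth_of w u \<and> (fst p = fst u \<or> Suc (fst p) = fst u)"
    using u by cases (simp_all add: cells_def depth_of_def)
  then show "p \<in> cells h w" "depth_of w p < depth_of w u" "fst p = fst u \<or> Suc (fst p) = fst u"
    by blast+
qed

lemma distinct_preds_of: "distinct (preds_of T w u)"
  by (cases "(T, w, u)" rule: preds_of.cases) auto

lemma length_preds_of: "length (preds_of T w u) \<le> 2"
  by (cases "(T, w, u)" rule: preds_of.cases) auto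

lemma comp_from_cong:
  "(\<And>t. g \<le> t \<Longrightarrow> t < g + n \<Longrightarrow> T t = S t) \<Longrightarrow> comp_from T g n = comp_from S g n"
  by (induction n) auto

lemma comp_from_add: "comp_from T g (m + n) = comp_from T g m \<circ> comp_from T (g + m) n"
  by (induction n) (auto simp: fun_eq_iff add.assoc)

lemma inj_linear_comp_from:
  "(\<And>t. g \<le> t \<Longrightarrow> t < g + n \<Longrightarrow> inj_linear w (T t)) \<Longrightarrow> inj_linear w (comp_from T g n)"
  by (induction n) (auto intro!: inj_linear_id inj_linear_comp)

lemma form_from_in_vecs:
  assumes "\<And>t. Suc t < h \<Longrightarrow> inj_linear w (T t)" "u \<in> cells h w"
  shows "form_from T g u \<in> vecs w"
proof -
  obtain t i j where u: "u = (t, i, j)" "t < h" "i < w"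
    using assms(2) by (auto simp: cells_def)
  show ?thesis
  proof (cases t)
    case (Suc t')
    have T: "inj_linear w (T s)" if "s \<le> t'" for s
      using assms(1) that u(2) Suc by simp
    have "inj_linear w (comp_from T g (t' - g))"
      using T by (intro inj_linear_comp_from) simp
    moreover have "T t' (unitv i) \<in> vecs w"
      using u(3) by (intro inj_linear_in_vecs[OF T] unitv_in_vecs) simp_all
    ultimately show ?thesis
      using u(1) Suc by (simp add: inj_linear_in_vecs trunc_in_vecs)
  qed (simp add: u unitv_in_vecs)
qed

lemma form_from_fun_upd_after:
  assumes "fst u \<le> k"
  shows "form_from (T(k := \<sigma>)) 0 u = form_from T 0 u"
proof -
  obtain t i j where u: "u = (t, i, j)" by (cases u) auto
  show ?thesis
  proof (cases t)
    case (Suc t')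
    then have "comp_from (T(k := \<sigma>)) 0 t' = comp_from T 0 t'"
      using assms u by (intro comp_from_cong) simp
    then show ?thesis
      using assms u Suc by simp
  qed (simp add: u)
qed

lemma form_from_fun_upd_across:
  assumes "Suc k < fst u"
  shows "form_from (T(k := \<sigma>)) 0 u = comp_from T 0 k (\<sigma> (form_from T (Suc k) u))"
proof -
  let ?T = "T(k := \<sigma>)"
  obtain t i j where u: "u = (Suc t, i, j)" "k < t"
    using assms by (cases u; cases "fst u") auto
  have "comp_from ?T 0 t = comp_from ?T 0 (Suc k) \<circ> comp_from ?T (Suc k) (t - Suc k)"
    using comp_from_add[of ?T 0 "Suc k" "t - Suc k"] u(2) by simp
  also have "comp_from ?T (Suc k) (t - Suc k) = comp_from T (Suc k) (t - Suc k)"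
    by (intro comp_from_cong) simp
  also have "comp_from ?T 0 (Suc k) = comp_from T 0 k \<circ> \<sigma>"
    using comp_from_cong[of 0 k ?T T] by simp
  finally have "comp_from ?T 0 t = comp_from T 0 k \<circ> \<sigma> \<circ> comp_from T (Suc k) (t - Suc k)" .
  then show ?thesis
    using u by (simp del: fun_upd_apply) simp
qed

lemma sum_preds_of:
  "sum f (set (preds_of T w (Suc t, i, j))) =
     (if j = 0 then 0 else f (Suc t, i, j - 1)) +
     (if T t (unitv i) j = 1 then f (t, j, w - 1) else 0)"
  by (simp add: add.commute)

lemma form_from_eq_sum_preds:
  assumes T: "\<And>t. Suc t < h \<Longrightarrow> inj_linear w (T t)" and u: "u \<in> cells h w" "1 \<le> fst u"
  shows "form_from T 0 u = sum (form_from T 0) (set (preds_of T w u))"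
proof -
  obtain t i j where u_eq: "u = (Suc t, i, j)" "Suc t < h" "i < w" "j < w"
    using u by (cases u; cases "fst u") (auto simp: cells_def)
  let ?L = "comp_from T 0 t" and ?row = "T t (unitv i)"
  have lin_comp: "inj_linear w ?L"
    using T u_eq(2) by (intro inj_linear_comp_from) simp
  have row: "?row \<in> vecs w"
    using u_eq by (intro inj_linear_in_vecs[OF T] unitv_in_vecs)
  have state: "?L (unitv j) = form_from T 0 (t, j, w - 1)"
  proof (cases t)
    case (Suc t')
    then have "T t' (unitv j) \<in> vecs w"
      using u_eq by (intro inj_linear_in_vecs[OF T] unitv_in_vecs) simp_all
    then show ?thesis
      using Suc u_eq(4) by (simp add: trunc_eq_self)
  qed simp
  have "form_from T 0 u = ?L (trunc j ?row + (if ?row j = 1 then unitv j else 0))"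
    by (simp add: u_eq(1) trunc_Suc)
  also have "\<dots> = ?L (trunc j ?row) + ?L (if ?row j = 1 then unitv j else 0)"
    using row u_eq(4)
    by (intro inj_linear_add[OF lin_comp]) (simp_all add: trunc_in_vecs unitv_in_vecs)
  also have "?L (trunc j ?row) = (if j = 0 then 0 else form_from T 0 (Suc t, i, j - 1))"
    using inj_linear_0[OF lin_comp] by (cases j) simp_all
  also have "?L (if ?row j = 1 then unitv j else 0)
      = (if ?row j = 1 then form_from T 0 (t, j, w - 1) else 0)"
    using state inj_linear_0[OF lin_comp] by simp
  finally show ?thesis
    unfolding u_eq(1) sum_preds_of .
qed

lemma form_from_last_nonzero:
  assumes T: "\<And>t. Suc t < h \<Longrightarrow> inj_linear w (T t)" and "2 \<le> h" "1 \<le> w"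
  shows "form_from T 0 (h - 1, 0, w - 1) \<noteq> 0"
proof -
  obtain t where h: "h = Suc (Suc t)"
    using assms(2) by (intro that[of "h - 2"]) simp
  have row: "T t (unitv 0) \<in> vecs w"
    using assms h by (intro inj_linear_in_vecs[OF T] unitv_in_vecs) simp_all
  moreover have "T t (unitv 0) \<noteq> 0"
    using T assms h by (subst inj_linear_eq_0_iff[of w "T t"]) (simp_all add: unitv_in_vecs)
  moreover have "inj_linear w (comp_from T 0 t)"
    using T h by (intro inj_linear_comp_from) simp
  ultimately show ?thesis
    using assms(3) by (simp add: h trunc_eq_self inj_linear_eq_0_iff)
qed

definition coincidence :: "(nat \<Rightarrow> bitvec \<Rightarrow> bitvec) \<Rightarrow> cell set \<Rightarrow> cell set \<Rightarrow> bool" where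
  "coincidence T A B \<longleftrightarrow>
     sum (form_from T 0) A = sum (form_from T 0) B \<and> sum (form_from T 0) B \<noteq> 0"

lemma sum_form_from_fun_upd_across:
  assumes "\<And>t. Suc t < h \<Longrightarrow> inj_linear w (T t)" "inj_linear w \<sigma>" "Suc k < h"
    and "B \<subseteq> cells h w" "\<And>u. u \<in> B \<Longrightarrow> Suc k < fst u"
  shows "sum (form_from (T(k := \<sigma>)) 0) B = comp_from T 0 k (\<sigma> (sum (form_from T (Suc k)) B))"
proof -
  have lin_comp: "inj_linear w (comp_from T 0 k)"
    using assms(1,3) by (intro inj_linear_comp_from) simp
  have forms: "form_from T (Suc k) u \<in> vecs w" if "u \<in> B" for u
    using assms(1,4) that by (intro form_from_in_vecs[of h]) auto
  have "sum (form_from (T(k := \<sigma>)) 0) B = (\<Sum>u\<in>B. comp_from T 0 k (\<sigma> (form_from T (Suc k) u)))"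
    using assms(5) by (intro sum.cong) (simp_all add: form_from_fun_upd_across)
  also have "\<dots> = comp_from T 0 k (\<Sum>u\<in>B. \<sigma> (form_from T (Suc k) u))"
    using forms by (intro inj_linear_sum[OF lin_comp, symmetric] inj_linear_in_vecs[OF assms(2)])
  also have "(\<Sum>u\<in>B. \<sigma> (form_from T (Suc k) u)) = \<sigma> (sum (form_from T (Suc k)) B)"
    using forms by (intro inj_linear_sum[OF assms(2), symmetric])
  finally show ?thesis .
qed

text \<open>With all maps but \<open>T k\<close> fixed, a coincidence across block \<open>Suc k\<close> prescribes the image under
  \<open>T k\<close> of a fixed nonzero vector.\<close>

lemma card_GL_coincidence_le:
  assumes T: "\<And>t. Suc t < h \<Longrightarrow> inj_linear w (T t)" and k: "Suc k < h"
    and A: "\<And>u. u \<in> A \<Longrightarrow> fst u \<le> k" and B: "B \<subseteq> cells h w" "\<And>u. u \<in> B \<Longrightarrow> Suc k < fst u"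
  shows "(2 ^ w - 1) * card {\<sigma> \<in> GL w. coincidence (T(k := \<sigma>)) A B} \<le> card (GL w)"
proof (cases "{\<sigma> \<in> GL w. coincidence (T(k := \<sigma>)) A B} = {}")
  case False
  let ?S = "{\<sigma> \<in> GL w. coincidence (T(k := \<sigma>)) A B}" and ?L = "comp_from T 0 k"
  define \<mu> where "\<mu> = sum (form_from T (Suc k)) B"
  have lin_comp: "inj_linear w ?L"
    using k T by (intro inj_linear_comp_from) simp
  have \<mu>: "\<mu> \<in> vecs w"
    unfolding \<mu>_def using T B(1) by (intro sum_in_vecs form_from_in_vecs[of h]) auto
  have sum_A: "sum (form_from (T(k := \<sigma>)) 0) A = sum (form_from T 0) A" for \<sigma>
    using A by (intro sum.cong) (simp_all add: form_from_fun_upd_after)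
  have coincidence: "inj_linear w \<sigma>" "sum (form_from T 0) A = ?L (\<sigma> \<mu>)" "?L (\<sigma> \<mu>) \<noteq> 0"
    if "\<sigma> \<in> ?S" for \<sigma>
    using that sum_A[of \<sigma>] sum_form_from_fun_upd_across[of h w T \<sigma> k B, OF T _ k B]
      GL_inj_linear[of \<sigma>]
    by (auto simp: coincidence_def \<mu>_def)
  obtain \<sigma> where \<sigma>: "\<sigma> \<in> ?S"
    using False by blast
  have "\<mu> \<noteq> 0"
    using coincidence(1,3)[OF \<sigma>] inj_linear_0[OF lin_comp] inj_linear_0[of w \<sigma>] by auto
  have "\<tau> \<mu> = \<sigma> \<mu>" if "\<tau> \<in> ?S" for \<tau>
    using inj_linear_eq_iff[OF lin_comp inj_linear_in_vecs inj_linear_in_vecs, OF _ \<mu> _ \<mu>]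
      coincidence(1,2)[OF that] coincidence(1,2)[OF \<sigma>] by metis
  then have "card ?S \<le> card {\<tau> \<in> GL w. \<tau> \<mu> = \<sigma> \<mu>}"
    by (intro card_mono) (auto simp: finite_GL)
  then have "(2 ^ w - 1) * card ?S \<le> (2 ^ w - 1) * card {\<tau> \<in> GL w. \<tau> \<mu> = \<sigma> \<mu>}"
    by (rule mult_le_mono2)
  also have "\<dots> \<le> card (GL w)"
    using \<mu> \<open>\<mu> \<noteq> 0\<close> by (rule card_GL_fibre_le)
  finally show ?thesis .
qed (simp only: card.empty mult_0_right zero_le)

definition separated_sets :: "nat \<Rightarrow> nat \<Rightarrow> nat \<Rightarrow> (nat \<times> cell set \<times> cell set) set" where
  "separated_sets h w d = {(k, A, B). Suc k < h \<and>
     A \<subseteq> cells h w \<and> A \<noteq> {} \<and> card A \<le> d \<and> (\<forall>u\<in>A. fst u \<le> k) \<and>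
     B \<subseteq> cells h w \<and> B \<noteq> {} \<and> card B \<le> d + 1 \<and> (\<forall>u\<in>B. Suc k < fst u)}"

lemma finite_separated_sets: "finite (separated_sets h w d)"
  and card_separated_sets_le: "card (separated_sets h w d) \<le> h * card (cells h w) ^ (2 * d + 1)"
proof -
  define subsets where "subsets l = {S. S \<subseteq> cells h w \<and> S \<noteq> {} \<and> card S \<le> l}" for l
  let ?E = "{..<h} \<times> subsets d \<times> subsets (d + 1)"
  have subsets: "finite (subsets l)" "card (subsets l) \<le> card (cells h w) ^ l" for l
    unfolding subsets_def
    using finite_nonempty_subsets[OF finite_cells] card_nonempty_subsets_le[OF finite_cells] by auto
  have sub: "separated_sets h w d \<subseteq> ?E"
    by (auto simp: separated_sets_def subsets_def)
  have fin: "finite ?E"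
    by (simp add: subsets)
  show "finite (separated_sets h w d)"
    using sub fin by (rule finite_subset)
  have "card (separated_sets h w d) \<le> card ?E"
    using fin sub by (rule card_mono)
  also have "\<dots> \<le> h * (card (cells h w) ^ d * card (cells h w) ^ (d + 1))"
    unfolding card_cartesian_product by (intro mult_le_mono subsets) simp
  also have "\<dots> = h * card (cells h w) ^ (2 * d + 1)"
    by (simp flip: power_add add: mult_2)
  finally show "card (separated_sets h w d) \<le> h * card (cells h w) ^ (2 * d + 1)" .
qed

definition coincidence_free :: "nat \<Rightarrow> nat \<Rightarrow> nat \<Rightarrow> (nat \<Rightarrow> bitvec \<Rightarrow> bitvec) \<Rightarrow> bool" where
  "coincidence_free h w d T \<longleftrightarrow> (\<forall>(k, A, B)\<in>separated_sets h w d. \<not> coincidence T A B)"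

lemma coincidence_free_maps_exist:
  assumes "Suc (h * card (cells h w) ^ (2 * d + 1)) < 2 ^ w"
  shows "\<exists>T. (\<forall>t. Suc t < h \<longrightarrow> inj_linear w (T t)) \<and> coincidence_free h w d T"
proof -
  let ?\<Omega> = "{..<h - 1} \<rightarrow>\<^sub>E GL w"
  have lin: "inj_linear w (T t)" if "T \<in> ?\<Omega>" "Suc t < h" for T t
    using that by (intro GL_inj_linear) (auto simp: PiE_iff)
  have improbable: "(2 ^ w - 1) * card {T \<in> ?\<Omega>. case e of (k, A, B) \<Rightarrow> coincidence T A B} \<le> card ?\<Omega>"
    if "e \<in> separated_sets h w d" for e
  proof -
    obtain k A B where e: "e = (k, A, B)"
      by (cases e)
    have "(2 ^ w - 1) * card {T \<in> ?\<Omega>. coincidence T A B} \<le> card ?\<Omega>"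
    proof (rule card_PiE_fibres_le)
      show "k \<in> {..<h - 1}"
        using that by (auto simp: e separated_sets_def)
      show "(2 ^ w - 1) * card {\<sigma> \<in> GL w. coincidence (T(k := \<sigma>)) A B} \<le> card (GL w)"
        if "T \<in> ?\<Omega>" for T
        using \<open>e \<in> separated_sets h w d\<close> lin[OF that]
        by (intro card_GL_coincidence_le[of h]) (auto simp: e separated_sets_def)
    qed (simp_all add: finite_GL)
    then show ?thesis
      by (simp add: e)
  qed
  have "finite ?\<Omega>" "?\<Omega> \<noteq> {}"
    by (auto simp: finite_GL GL_nonempty PiE_eq_empty_iff intro!: finite_PiE)
  moreover have "card (separated_sets h w d) < 2 ^ w - 1"
    using card_separated_sets_le[of h w d] assms by linarith
  ultimately have "\<exists>T\<in>?\<Omega>. \<forall>e\<in>separated_sets h w d. \<not> (case e of (k, A, B) \<Rightarrow> coincidence T A B)"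
    using finite_separated_sets improbable by (intro union_bound)
  then obtain T where "T \<in> ?\<Omega>" "coincidence_free h w d T"
    by (auto simp: coincidence_free_def split_def)
  then show ?thesis
    using lin by blast
qed

lemma coincidence_freeD:
  assumes "coincidence_free h w d T" "A \<subseteq> cells h w" "B \<subseteq> cells h w" "card A \<le> d" "card B \<le> d + 1"
    and "\<And>u. u \<in> A \<Longrightarrow> fst u \<le> k" "\<And>u. u \<in> B \<Longrightarrow> Suc k < fst u"
    and "sum (form_from T 0) A = sum (form_from T 0) B"
  shows "sum (form_from T 0) B = 0"
proof (cases "A = {} \<or> B = {}")
  case False
  then have "Suc k < h"
    using assms(3,7) by (force simp: cells_def)
  then have "(k, A, B) \<in> separated_sets h w d"
    using False assms by (simp add: separated_sets_def)
  then have "\<not> coincidence T A B"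
    using assms(1) by (auto simp: coincidence_free_def)
  then show ?thesis
    using assms(8) by (simp add: coincidence_def)
qed (use assms(8) in auto)

section \<open>Hardness condensation\<close>

lemma of_nat_bit: "(of_nat n :: bit) = of_bool (odd n)"
  by (induction n) simp_all

lemma odd_card_sym_diff:
  assumes "finite A" "finite B"
  shows "odd (card (sym_diff A B)) \<longleftrightarrow> odd (card A) \<noteq> odd (card B)"
proof -
  have "card (A - B) + card (A \<inter> B) = card A" "card (B - A) + card (A \<inter> B) = card B"
    using assms card_Int_Diff[of A B] card_Int_Diff[of B A] by (simp_all add: Int_commute)
  moreover have "card (sym_diff A B) = card (A - B) + card (B - A)"
    using assms by (intro card_Un_disjoint) auto
  ultimately show ?thesis
    by presburger
qed

locale xor_compression =
  fixes U :: "'v set" and \<gamma> :: "'v \<Rightarrow> nat \<Rightarrow> nat" and D N d :: nat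
  assumes finite_U: "finite U"
    and \<gamma>_less: "u \<in> U \<Longrightarrow> i < D \<Longrightarrow> \<gamma> u i < N"
    and expander: "unique_nbr_expander \<gamma> D U (2 * d)"
begin

definition val :: "(nat \<Rightarrow> bit) \<Rightarrow> 'v set \<Rightarrow> bit" where
  "val \<beta> A = (\<Sum>u\<in>A. \<Sum>i<D. \<beta> (\<gamma> u i))"

definition odd_nbrs :: "'v set \<Rightarrow> nat set" where
  "odd_nbrs A = {v. odd (card (edges_to \<gamma> D A v))}"

definition determined :: "nat set \<Rightarrow> 'v set set" where
  "determined Q = {A. A \<subseteq> U \<and> card A \<le> d \<and> odd_nbrs A \<subseteq> Q}"

definition closure :: "nat set \<Rightarrow> 'v set" where
  "closure Q = \<Union> (determined Q)"

lemma finite_if_subset_U: "A \<subseteq> U \<Longrightarrow> finite A"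
  using finite_U finite_subset by blast

lemma odd_nbrs_subset_nbrs: "odd_nbrs A \<subseteq> nbrs \<gamma> D A"
proof
  fix v assume "v \<in> odd_nbrs A"
  then have "edges_to \<gamma> D A v \<noteq> {}"
    by (auto simp: odd_nbrs_def)
  then show "v \<in> nbrs \<gamma> D A"
    by (simp add: edges_to_empty_iff)
qed

lemma odd_nbrs_less: "A \<subseteq> U \<Longrightarrow> v \<in> odd_nbrs A \<Longrightarrow> v < N"
  using odd_nbrs_subset_nbrs \<gamma>_less by (fastforce simp: nbrs_def)

lemma finite_odd_nbrs: "A \<subseteq> U \<Longrightarrow> finite (odd_nbrs A)"
  using finite_subset[OF odd_nbrs_subset_nbrs finite_nbrs[OF finite_if_subset_U]] .

lemma odd_nbrs_sym_diff:
  assumes "finite A" "finite B"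
  shows "odd_nbrs (sym_diff A B) = sym_diff (odd_nbrs A) (odd_nbrs B)"
proof -
  have "edges_to \<gamma> D (sym_diff A B) v = sym_diff (edges_to \<gamma> D A v) (edges_to \<gamma> D B v)" for v
    by (auto simp: edges_to_def)
  then show ?thesis
    using assms by (auto simp: odd_nbrs_def odd_card_sym_diff finite_edges_to)
qed

lemma val_eq_sum_odd_nbrs:
  assumes "A \<subseteq> U"
  shows "val \<beta> A = sum \<beta> (odd_nbrs A)"
proof -
  let ?\<gamma> = "\<lambda>(u, i). \<gamma> u i"
  have fin: "finite (A \<times> {..<D})" "finite (nbrs \<gamma> D A)"
    using finite_if_subset_U[OF assms] by (simp_all add: finite_nbrs)
  have "?\<gamma> ` (A \<times> {..<D}) \<subseteq> nbrs \<gamma> D A"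
    by (auto simp: nbrs_def)
  then have "val \<beta> A = (\<Sum>v\<in>nbrs \<gamma> D A. \<Sum>e | e \<in> A \<times> {..<D} \<and> ?\<gamma> e = v. \<beta> (?\<gamma> e))"
    using sum.group[OF fin, of ?\<gamma> "\<lambda>e. \<beta> (?\<gamma> e)"]
    by (simp add: val_def sum.cartesian_product split_def)
  also have "\<dots> = (\<Sum>v\<in>nbrs \<gamma> D A. \<Sum>e\<in>edges_to \<gamma> D A v. \<beta> v)"
    by (intro sum.cong) (auto simp: edges_to_def)
  also have "\<dots> = (\<Sum>v\<in>nbrs \<gamma> D A. if v \<in> odd_nbrs A then \<beta> v else 0)"
    by (intro sum.cong) (auto simp: odd_nbrs_def of_nat_bit)
  also have "\<dots> = sum \<beta> (nbrs \<gamma> D A \<inter> odd_nbrs A)"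
    using fin(2) by (rule sum.inter_restrict[symmetric])
  also have "nbrs \<gamma> D A \<inter> odd_nbrs A = odd_nbrs A"
    using odd_nbrs_subset_nbrs by (rule Int_absorb1)
  finally show ?thesis .
qed

lemma val_sym_diff:
  "finite A \<Longrightarrow> finite B \<Longrightarrow> val \<beta> (sym_diff A B) = val \<beta> A + val \<beta> B"
  unfolding val_def by (rule sum_sym_diff_char_2)

lemma val_cong: "A \<subseteq> U \<Longrightarrow> (\<And>v. v \<in> odd_nbrs A \<Longrightarrow> \<beta> v = \<beta>' v) \<Longrightarrow> val \<beta> A = val \<beta>' A"
  by (simp add: val_eq_sum_odd_nbrs)

lemma val_fun_upd:
  assumes "A \<subseteq> U" "v \<in> odd_nbrs A"
  shows "val (\<beta>(v := b)) A = b + val (\<beta>(v := 0)) A"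
  using assms finite_odd_nbrs[OF assms(1)]
  by (simp add: val_eq_sum_odd_nbrs sum.remove[of _ v] del: add_bit_eq_xor)

lemma determinedD:
  assumes "A \<in> determined Q"
  shows "A \<subseteq> U" "card A \<le> d" "odd_nbrs A \<subseteq> Q" "finite A"
  using assms finite_if_subset_U by (auto simp: determined_def)

lemma determined_mono: "Q \<subseteq> Q' \<Longrightarrow> determined Q \<subseteq> determined Q'"
  by (auto simp: determined_def)

lemma closure_mono: "Q \<subseteq> Q' \<Longrightarrow> closure Q \<subseteq> closure Q'"
  unfolding closure_def using determined_mono by blast

lemma unique_nbrs_Union_subset:
  assumes "\<F> \<subseteq> determined Q"
  shows "unique_nbrs \<gamma> D (\<Union>\<F>) \<subseteq> Q"
proof
  fix v assume "v \<in> unique_nbrs \<gamma> D (\<Union>\<F>)"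
  then have "card (edges_to \<gamma> D (\<Union>\<F>) v) = 1"
    by (simp add: unique_nbrs_def)
  then obtain e where e: "edges_to \<gamma> D (\<Union>\<F>) v = {e}"
    by (rule card_1_singletonE)
  then have "e \<in> edges_to \<gamma> D (\<Union>\<F>) v"
    by simp
  then obtain A where A: "A \<in> \<F>" "e \<in> edges_to \<gamma> D A v"
    by (auto simp: edges_to_def)
  moreover have "edges_to \<gamma> D A v \<subseteq> edges_to \<gamma> D (\<Union>\<F>) v"
    using A(1) by (auto simp: edges_to_def)
  ultimately have "edges_to \<gamma> D A v = {e}"
    using e by blast
  then have "v \<in> odd_nbrs A"
    by (simp add: odd_nbrs_def)
  then show "v \<in> Q"
    using A(1) assms by (auto dest: determinedD(3))
qed

lemma closure_subset_U: "closure Q \<subseteq> U"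
  by (auto simp: closure_def dest: determinedD(1))

text \<open>When the union of determined sets grows by one set of size at most \<open>d\<close>, it stays within the
  range of the expansion property, which cuts its size down to \<open>card Q\<close> again.\<close>

lemma card_closure_le:
  assumes "finite Q" "card Q \<le> d"
  shows "card (closure Q) \<le> card Q"
proof -
  have "card (\<Union>\<F>) \<le> card Q" if "finite \<F>" "\<F> \<subseteq> determined Q" for \<F>
    using that
  proof (induction \<F>)
    case (insert A \<F>)
    have "card (\<Union>(insert A \<F>)) \<le> card A + card (\<Union>\<F>)"
      using card_Un_le[of A "\<Union>\<F>"] by simp
    also have "\<dots> \<le> 2 * d"
      using insert determinedD(2)[of A Q] assms(2) by auto
    finally have "card (\<Union>(insert A \<F>)) \<le> 2 * d" .
    moreover have "\<Union>(insert A \<F>) \<subseteq> U"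
      using insert.prems by (auto simp: determined_def)
    ultimately have "card (\<Union>(insert A \<F>)) \<le> card (unique_nbrs \<gamma> D (\<Union>(insert A \<F>)))"
      using expander unfolding unique_nbr_expander_def by blast
    also have "\<dots> \<le> card Q"
      by (rule card_mono[OF assms(1) unique_nbrs_Union_subset[OF insert.prems]])
    finally show ?case .
  qed simp
  moreover have "finite (determined Q)"
    using finite_U by (intro finite_subset[of "determined Q" "Pow U"]) (auto simp: determined_def)
  ultimately show ?thesis
    by (simp add: closure_def)
qed

lemma determined_empty: "determined {} \<subseteq> {{}}"
proof -
  have "closure {} = {}"
    using card_closure_le[of "{}"] finite_if_subset_U[OF closure_subset_U] by simp
  then show ?thesis
    by (auto simp: closure_def)
qed

lemma determined_sym_diff:
  assumes "finite Q" "card Q \<le> d" "A \<in> determined Q" "B \<in> determined Q"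
  shows "sym_diff A B \<in> determined Q"
proof -
  have "sym_diff A B \<subseteq> closure Q"
    using assms(3,4) by (auto simp: closure_def)
  then have "card (sym_diff A B) \<le> card (closure Q)"
    by (intro card_mono finite_if_subset_U[OF closure_subset_U])
  then have "card (sym_diff A B) \<le> d"
    using card_closure_le[OF assms(1,2)] assms(2) by simp
  moreover have "odd_nbrs (sym_diff A B) \<subseteq> Q" "sym_diff A B \<subseteq> U"
    using determinedD[OF assms(3)] determinedD[OF assms(4)] by (auto simp: odd_nbrs_sym_diff)
  ultimately show ?thesis
    by (simp add: determined_def)
qed

end

section \<open>Blockwise linear computations\<close>

locale linear_computation =
  fixes U :: "'v set" and preds :: "'v \<Rightarrow> 'v list" and blk depth :: "'v \<Rightarrow> nat"
    and form :: "'v \<Rightarrow> 'b::char_2" and top :: 'v and d :: nat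
  assumes preds_subset: "u \<in> U \<Longrightarrow> set (preds u) \<subseteq> U"
    and preds_depth: "u \<in> U \<Longrightarrow> p \<in> set (preds u) \<Longrightarrow> depth p < depth u"
    and preds_distinct: "u \<in> U \<Longrightarrow> distinct (preds u)"
    and preds_length: "u \<in> U \<Longrightarrow> length (preds u) \<le> 2"
    and preds_blk: "u \<in> U \<Longrightarrow> p \<in> set (preds u) \<Longrightarrow> blk p = blk u \<or> Suc (blk p) = blk u"
    and form_eq_sum_preds: "u \<in> U \<Longrightarrow> 1 \<le> blk u \<Longrightarrow> form u = sum form (set (preds u))"
    and gap: "1 \<le> g \<Longrightarrow> A \<subseteq> U \<Longrightarrow> B \<subseteq> U \<Longrightarrow>
      (\<And>u. u \<in> A \<Longrightarrow> blk u < g) \<Longrightarrow> (\<And>u. u \<in> B \<Longrightarrow> g < blk u) \<Longrightarrow>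
      card A \<le> d \<Longrightarrow> card B \<le> d + 1 \<Longrightarrow> sum form A = sum form B \<Longrightarrow> sum form B = 0"
    and finite_U: "finite U" and top_in_U: "top \<in> U" and form_top: "form top \<noteq> 0"
begin

text \<open>If the last value is claimed to be \<open>1\<close>, and all values in blocks up to \<open>g\<close> are \<open>0\<close>, then
  a set \<open>A\<close> with \<open>forces g A s\<close> sums to \<open>s\<close>.\<close>

definition forces :: "nat \<Rightarrow> 'v set \<Rightarrow> bit \<Rightarrow> bool" where
  "forces g A s \<longleftrightarrow> sum form {u \<in> A. g < blk u} = (if s = 1 then form top else 0)"

lemma forces_empty: "forces g {} s \<longleftrightarrow> s = 0"
  using form_top by (cases s) (auto simp: forces_def)

lemma forces_sym_diff:
  assumes "finite A" "finite B" "forces g A s" "forces g B t"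
  shows "forces g (sym_diff A B) (s + t)"
proof -
  have above: "{u \<in> sym_diff A B. g < blk u} = sym_diff {u \<in> A. g < blk u} {u \<in> B. g < blk u}"
    by auto
  have "sum form {u \<in> sym_diff A B. g < blk u}
      = sum form {u \<in> A. g < blk u} + sum form {u \<in> B. g < blk u}"
    unfolding above using assms(1,2) by (intro sum_sym_diff_char_2) simp_all
  then show ?thesis
    using assms(3,4) by (cases s; cases t) (simp_all add: forces_def)
qed

text \<open>A claim about block \<open>g'\<close> splits at the unused block \<open>g\<close> into a sum below \<open>g\<close> that coincides
  with a sum above \<open>g\<close>; both vanish.\<close>

lemma forces_lift:
  assumes g: "1 \<le> g" "g' < g" "g < blk top"
    and A: "A \<subseteq> U" "card A \<le> d" "\<And>u. u \<in> A \<Longrightarrow> blk u \<noteq> g"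
    and forces: "forces g' A s"
  shows "forces g A s"
proof -
  let ?below = "{u \<in> A. g' < blk u \<and> blk u < g}" and ?above = "{u \<in> A. g < blk u}"
  let ?T = "if s = 1 then {top} else {}"
  have fin: "finite A"
    using A(1) finite_U by (rule finite_subset)
  have "{u \<in> A. g' < blk u} = ?below \<union> ?above"
    using A(3) g(2) by (auto simp: nat_neq_iff)
  moreover have "sum form (?below \<union> ?above) = sum form ?below + sum form ?above"
    using fin by (intro sum.union_disjoint) auto
  moreover have "sum form {u \<in> A. g' < blk u} = sum form ?T"
    using forces by (simp add: forces_def)
  ultimately have "sum form ?below = sum form ?above + sum form ?T"
    by (simp add: add_eq_iff_char_2 add.commute)
  also have "\<dots> = sum form (sym_diff ?above ?T)"
    using fin by (intro sum_sym_diff_char_2[symmetric]) simp_all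
  finally have below_eq: "sum form ?below = sum form (sym_diff ?above ?T)" .
  have "card ?below \<le> d" "card ?above \<le> d"
    using fin A(2) by (auto intro: order_trans[OF card_mono])
  moreover have "card (sym_diff ?above ?T) \<le> card (insert top ?above)"
    using fin by (intro card_mono) auto
  ultimately have "sum form (sym_diff ?above ?T) = 0"
    using A(1) g(3) top_in_U fin
    by (intro gap[OF g(1) _ _ _ _ _ _ below_eq]) (auto simp: card_insert_if split: if_splits)
  then have "sum form ?above = sum form ?T"
    using fin by (subst (asm) sum_sym_diff_char_2) (simp_all add: add_eq_iff_char_2)
  then show ?thesis
    by (simp add: forces_def)
qed

end

section \<open>The pebble game\<close>

locale compressed_computation =
  xor_compression U \<gamma> D "n div 2" d + linear_computation U preds blk depth form top d
  for U :: "'v::countable set" and \<gamma> D n d preds blk depth and form :: "'v \<Rightarrow> 'b::char_2" and top +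
  assumes D: "1 \<le> D" and d: "3 \<le> d"
begin

definition obeys :: "nat \<Rightarrow> nat set \<Rightarrow> (nat \<Rightarrow> bit) \<Rightarrow> bool" where
  "obeys g Q \<beta> \<longleftrightarrow> (\<forall>A\<in>determined Q. \<forall>s. forces g A s \<longrightarrow> val \<beta> A = s)"

text \<open>To the observer of the variables in \<open>Q\<close>, the flips \<open>\<beta>\<close> look as if all blocks below the
  unobserved block \<open>g\<close> were computed from the true inputs, while all blocks above \<open>g\<close> were
  computed from unconstrained inputs subject only to the last value being \<open>1\<close>.\<close>

definition consistent :: "nat \<Rightarrow> nat set \<Rightarrow> (nat \<Rightarrow> bit) \<Rightarrow> bool" where
  "consistent g Q \<beta> \<longleftrightarrow>
     (\<forall>u\<in>closure Q. blk u \<noteq> g) \<and> (\<forall>v\<ge>n div 2. \<beta> v = 0) \<and> obeys g Q \<beta>"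

lemma consistent_antimono: "consistent g Q' \<beta> \<Longrightarrow> Q \<subseteq> Q' \<Longrightarrow> consistent g Q \<beta>"
  using determined_mono[of Q Q'] closure_mono[of Q Q'] unfolding consistent_def obeys_def by blast

lemma consistent_empty: "consistent g {} (\<lambda>_. 0)"
proof -
  have "obeys g {} (\<lambda>_. 0)"
    using determined_empty by (auto simp: obeys_def forces_empty val_def)
  moreover have "closure {} = {}"
    using determined_empty by (auto simp: closure_def)
  ultimately show ?thesis
    by (simp add: consistent_def)
qed

lemma obeys_lower:
  assumes "consistent g Q \<beta>" "1 \<le> g" "g' < g" "g < blk top"
  shows "obeys g' Q \<beta>"
  unfolding obeys_def
proof (intro ballI allI impI)
  fix A s assume A: "A \<in> determined Q" "forces g' A s"
  have "blk u \<noteq> g" if "u \<in> A" for u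
    using assms(1) A(1) that by (auto simp: consistent_def closure_def)
  then have "forces g A s"
    using A determinedD(1,2)[OF A(1)] assms(2-4) by (intro forces_lift[of g g'])
  then show "val \<beta> A = s"
    using assms(1) A(1) by (simp add: consistent_def obeys_def)
qed

lemma obeys_insertI:
  assumes "obeys g Q \<beta>"
    and new: "\<And>A s. A \<in> determined (insert v Q) \<Longrightarrow> v \<in> odd_nbrs A \<Longrightarrow> forces g A s \<Longrightarrow>
      val (\<beta>(v := b)) A = s"
  shows "obeys g (insert v Q) (\<beta>(v := b))"
  unfolding obeys_def
proof (intro ballI allI impI)
  fix A s assume A: "A \<in> determined (insert v Q)" "forces g A s"
  show "val (\<beta>(v := b)) A = s"
  proof (cases "v \<in> odd_nbrs A")
    case False
    then have "A \<in> determined Q"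
      using A(1) by (auto simp: determined_def)
    then have "val \<beta> A = s"
      using assms(1) A(2) by (simp add: obeys_def)
    moreover have "val (\<beta>(v := b)) A = val \<beta> A"
      using False determinedD(1)[OF A(1)] by (intro val_cong) auto
    ultimately show ?thesis
      by simp
  qed (use A new in blast)
qed

text \<open>Two newly determined sets both involve \<open>v\<close>, so they differ by a set determined already.
  Hence any one of them fixes the value of \<open>v\<close> for all.\<close>

lemma newly_determined_agree:
  assumes "obeys g Q \<beta>" "v \<notin> Q" "finite Q" "card (insert v Q) \<le> d"
    and A: "A \<in> determined (insert v Q)" "v \<in> odd_nbrs A" "forces g A s"
    and B: "B \<in> determined (insert v Q)" "v \<in> odd_nbrs B" "forces g B t"
  shows "val (\<beta>(v := 0)) A + val (\<beta>(v := 0)) B = s + t"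
proof -
  have fin: "finite A" "finite B"
    using A B determinedD by blast+
  have "sym_diff A B \<in> determined (insert v Q)"
    using A B assms(3,4) by (intro determined_sym_diff) auto
  then have sym_diff: "sym_diff A B \<in> determined Q"
    using A B fin by (auto simp: determined_def odd_nbrs_sym_diff)
  have "val (\<beta>(v := 0)) A + val (\<beta>(v := 0)) B = val (\<beta>(v := 0)) (sym_diff A B)"
    using fin by (intro val_sym_diff[symmetric])
  also have "\<dots> = val \<beta> (sym_diff A B)"
    using determinedD(1,3)[OF sym_diff] assms(2) by (intro val_cong) auto
  also have "\<dots> = s + t"
    using assms(1) sym_diff forces_sym_diff[OF fin A(3) B(3)]
    by (simp add: obeys_def del: add_bit_eq_xor)
  finally show ?thesis .
qed

lemma obeys_extend:
  assumes "obeys g Q \<beta>" "v \<notin> Q" "finite Q" "card (insert v Q) \<le> d"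
  obtains b where "n div 2 \<le> v \<Longrightarrow> b = 0" "obeys g (insert v Q) (\<beta>(v := b))"
proof (cases "\<exists>B\<in>determined (insert v Q). v \<in> odd_nbrs B \<and> (\<exists>t. forces g B t)")
  case False
  then show thesis
    using that[of 0] obeys_insertI[OF assms(1), of v 0] by blast
next
  case True
  then obtain B t where B: "B \<in> determined (insert v Q)" "v \<in> odd_nbrs B" "forces g B t"
    by blast
  define b where "b = t + val (\<beta>(v := 0)) B"
  have "obeys g (insert v Q) (\<beta>(v := b))"
  proof (rule obeys_insertI[OF assms(1)])
    fix A s assume A: "A \<in> determined (insert v Q)" "v \<in> odd_nbrs A" "forces g A s"
    have "val (\<beta>(v := b)) A = b + val (\<beta>(v := 0)) A"
      using determinedD(1)[OF A(1)] A(2) by (rule val_fun_upd)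
    also have "\<dots> = t + (val (\<beta>(v := 0)) A + val (\<beta>(v := 0)) B)"
      by (simp only: b_def add_ac)
    also have "\<dots> = s"
      unfolding newly_determined_agree[OF assms A B] by (simp only: add.commute[of s] add_add_self)
    finally show "val (\<beta>(v := b)) A = s" .
  qed
  moreover have "v < n div 2"
    using odd_nbrs_less[OF determinedD(1)[OF B(1)] B(2)] .
  ultimately show thesis
    using that[of b] by simp
qed

lemma unobserved_block_exists:
  assumes "finite Q" "card Q \<le> d" "d + 1 \<le> g"
  obtains g' where "g \<le> g' + (d + 1)" "g' < g" "\<And>u. u \<in> closure Q \<Longrightarrow> blk u \<noteq> g'"
proof -
  have fin: "finite (closure Q)"
    using closure_subset_U by (rule finite_if_subset_U)
  have "card (blk ` closure Q) \<le> card (closure Q)"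
    using fin by (rule card_image_le)
  also have "\<dots> < card {g - (d + 1)..<g}"
    using card_closure_le[OF assms(1,2)] assms(2,3) by simp
  finally have "\<not> {g - (d + 1)..<g} \<subseteq> blk ` closure Q"
    using card_mono[OF finite_imageI[OF fin]] by (meson not_le)
  then obtain g' where "g' \<in> {g - (d + 1)..<g}" "g' \<notin> blk ` closure Q"
    by blast
  then show thesis
    by (intro that[of g']) auto
qed

lemma consistent_extend:
  assumes consistent: "consistent g Q \<beta>" and Q: "finite Q" "card (insert v Q) \<le> d"
    and g: "d + 1 \<le> g" "g < blk top"
  obtains b g' where "g \<le> g' + (d + 1)" "g' < g" "consistent g' (insert v Q) (\<beta>(v := b))"
    "v \<in> Q \<Longrightarrow> b = \<beta> v"
proof -
  obtain g' where g': "g \<le> g' + (d + 1)" "g' < g" "\<And>u. u \<in> closure (insert v Q) \<Longrightarrow> blk u \<noteq> g'"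
    using unobserved_block_exists[of "insert v Q" g] Q g(1) by auto
  have obeys: "obeys g' Q \<beta>"
    using obeys_lower[OF consistent _ g'(2) g(2)] g(1) by simp
  show thesis
  proof (cases "v \<in> Q")
    case True
    then have "consistent g' (insert v Q) (\<beta>(v := \<beta> v))"
      using consistent obeys g'(3) by (simp add: consistent_def insert_absorb)
    then show thesis
      using g'(1,2) by (intro that) simp_all
  next
    case False
    then obtain b where "n div 2 \<le> v \<Longrightarrow> b = 0" "obeys g' (insert v Q) (\<beta>(v := b))"
      using obeys_extend[OF obeys _ Q] by blast
    then have "consistent g' (insert v Q) (\<beta>(v := b))"
      using consistent g'(3) by (simp add: consistent_def)
    then show thesis
      using g'(1,2) False by (intro that) simp_all
  qed
qed

end

section \<open>The structures\<close>

context compressed_computation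
begin

text \<open>\<open>Some u\<close> is the equation defining value \<open>u\<close>, and \<open>None\<close> the equation on the last value; they
  serve as relation symbols. The element \<open>a\<close> of the universe is the variable \<open>a div 2\<close> with
  value \<open>a mod 2\<close>; for odd \<open>n\<close> the element \<open>n - 1\<close> is padding.\<close>

definition equations :: "'v option set" where
  "equations = insert None (Some ` U)"

fun equation :: "'v option \<Rightarrow> 'v list" where
  "equation None = [top]"
| "equation (Some u) = u # preds u"

definition inputs :: "'v \<Rightarrow> nat list" where
  "inputs u = map (\<gamma> u) [0..<D]"

definition scope :: "'v option \<Rightarrow> nat list" where
  "scope e = concat (map inputs (equation e))"

definition vocabulary :: "nat vocabulary" where
  "vocabulary R = (if R \<in> to_nat ` equations then Some (length (scope (from_nat R))) else None)"

definition xor_structure :: "bit \<Rightarrow> (nat, nat) rel_structure" where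
  "xor_structure c = \<lparr>univ = {..<n},
     interp = (\<lambda>R. {as. map (\<lambda>a. a div 2) as = scope (from_nat R) \<and>
       (\<Sum>a\<leftarrow>as. of_nat a) = (if from_nat R = (None :: 'v option) then c else 0)})\<rparr>"

lemma univ_xor_structure [simp]: "univ (xor_structure c) = {..<n}"
  by (simp add: xor_structure_def)

lemma in_interp_xor_structure_iff:
  "as \<in> interp (xor_structure c) (to_nat (e :: 'v option)) \<longleftrightarrow>
     map (\<lambda>a. a div 2) as = scope e \<and> (\<Sum>a\<leftarrow>as. of_nat a) = (if e = None then c else 0)"
  by (simp add: xor_structure_def)

lemma vocabulary_eq_SomeE:
  assumes "vocabulary R = Some r"
  obtains e where "e \<in> equations" "R = to_nat e" "r = length (scope e)"
  using assms by (auto simp: vocabulary_def split: if_splits)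

lemma vocabulary_to_nat: "e \<in> equations \<Longrightarrow> vocabulary (to_nat e) = Some (length (scope e))"
  by (simp add: vocabulary_def)

lemma set_equation_subset: "e \<in> equations \<Longrightarrow> set (equation e) \<subseteq> U"
  using top_in_U by (auto simp: equations_def dest: subsetD[OF preds_subset])

lemma distinct_equation: "e \<in> equations \<Longrightarrow> distinct (equation e)"
  by (auto simp: equations_def preds_distinct dest: preds_depth)

lemma length_equation: "e \<in> equations \<Longrightarrow> 1 \<le> length (equation e) \<and> length (equation e) \<le> 3"
  using preds_length by (auto simp: equations_def)

lemma length_inputs [simp]: "length (inputs u) = D"
  by (simp add: inputs_def)

lemma length_scope: "length (scope e) = length (equation e) * D"
  by (simp add: scope_def length_concat o_def sum_list_triv)

lemma set_scope: "set (scope e) = nbrs \<gamma> D (set (equation e))"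
  by (auto simp: scope_def inputs_def nbrs_def)

lemma scope_less:
  assumes "e \<in> equations" "v \<in> set (scope e)"
  shows "v < n div 2"
  using assms set_equation_subset[OF assms(1)] \<gamma>_less by (auto simp: set_scope nbrs_def)

lemma sum_list_scope:
  assumes "e \<in> equations"
  shows "(\<Sum>v\<leftarrow>scope e. \<beta> v) = val \<beta> (set (equation e))"
proof -
  have "(\<Sum>v\<leftarrow>concat (map inputs us). \<beta> v) = (\<Sum>u\<leftarrow>us. \<Sum>i<D. \<beta> (\<gamma> u i))" for us
    by (induction us)
      (simp_all add: inputs_def o_def interv_sum_list_conv_sum_set_nat atLeast0LessThan)
  then show ?thesis
    using distinct_equation[OF assms]
    by (simp add: scope_def val_def sum_list_distinct_conv_sum_set)
qed

lemma n_pos: "0 < n"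
proof -
  have "\<gamma> top 0 < n div 2"
    using top_in_U D by (intro \<gamma>_less) auto
  then show ?thesis
    by simp
qed

lemma kary_xor_structure:
  assumes "3 * D \<le> k"
  shows "kary_structure k vocabulary (xor_structure c)"
proof -
  have "dom vocabulary = to_nat ` equations"
    by (auto simp: vocabulary_def dom_def)
  then have "finite (dom vocabulary)"
    using finite_U by (simp add: equations_def)
  moreover have "1 \<le> length (scope e) \<and> length (scope e) \<le> k" if "e \<in> equations" for e
  proof -
    have "1 * 1 \<le> length (scope e)" "length (scope e) \<le> 3 * D"
      using length_equation[OF that] D unfolding length_scope by (intro mult_le_mono; simp)+
    then show ?thesis
      using assms by linarith
  qed
  ultimately have "kary_vocabulary k vocabulary"
    by (auto simp: kary_vocabulary_def elim!: vocabulary_eq_SomeE)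
  moreover have "length as = length (scope e) \<and> set as \<subseteq> {..<n}"
    if "e \<in> equations" "as \<in> interp (xor_structure c) (to_nat e)" for e as
  proof -
    have as: "map (\<lambda>a. a div 2) as = scope e"
      using that(2) by (simp add: in_interp_xor_structure_iff)
    have "a < n" if "a \<in> set as" for a
    proof -
      have "a div 2 \<in> set (scope e)"
        using that by (simp flip: as)
      then have "a div 2 < n div 2"
        using scope_less \<open>e \<in> equations\<close> by blast
      then show ?thesis
        by linarith
    qed
    then show ?thesis
      using arg_cong[OF as, of length] by auto
  qed
  then have "finite_structure vocabulary (xor_structure c)"
    using n_pos by (auto simp: finite_structure_def elim!: vocabulary_eq_SomeE)
  ultimately show ?thesis
    by (simp add: kary_structure_def)
qed

lemma forces_equation:
  assumes e: "e \<in> equations" and g: "1 \<le> g" "g < blk top"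
    and unobserved: "\<And>u. u \<in> set (equation e) \<Longrightarrow> blk u \<noteq> g"
  shows "forces g (set (equation e)) (of_bool (e = None))"
proof (cases e)
  case None
  then have "{u \<in> set (equation e). g < blk u} = {top}"
    using g(2) by auto
  then show ?thesis
    using None by (simp add: forces_def)
next
  case (Some u)
  then have u: "u \<in> U"
    using e by (auto simp: equations_def)
  consider "blk u < g" | "g < blk u"
    using unobserved[of u] Some by fastforce
  then show ?thesis
  proof cases
    case 1
    then have above: "{v \<in> set (equation e). g < blk v} = {}"
      using Some preds_blk[OF u] by fastforce
    show ?thesis
      unfolding forces_def above using Some by simp
  next
    case 2
    have "g < blk p" if "p \<in> set (preds u)" for p
      using preds_blk[OF u that] unobserved[of p] that Some 2 by auto
    then have "{v \<in> set (equation e). g < blk v} = insert u (set (preds u))"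
      using Some 2 by auto
    moreover have "u \<notin> set (preds u)"
      using preds_depth[OF u] by blast
    ultimately show ?thesis
      using Some 2 by (simp add: forces_def form_eq_sum_preds[OF u])
  qed
qed

lemma consistent_equation:
  assumes consistent: "consistent g Q \<beta>" and g: "1 \<le> g" "g < blk top"
    and e: "e \<in> equations" "set (scope e) \<subseteq> Q"
  shows "(\<Sum>v\<leftarrow>scope e. \<beta> v) = of_bool (e = None)"
proof -
  let ?A = "set (equation e)"
  have "card ?A \<le> d"
    using card_length[of "equation e"] length_equation[OF e(1)] d by linarith
  then have A: "?A \<in> determined Q"
    using set_equation_subset[OF e(1)] odd_nbrs_subset_nbrs[of ?A] e(2)
    by (auto simp: determined_def set_scope)
  then have "blk u \<noteq> g" if "u \<in> ?A" for u
    using consistent that by (auto simp: consistent_def closure_def)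
  then have "forces g ?A (of_bool (e = None))"
    by (rule forces_equation[OF e(1) g])
  then show ?thesis
    using A consistent by (simp add: consistent_def obeys_def sum_list_scope[OF e(1)])
qed

end

section \<open>Equivalence in counting logic\<close>

lemma sat_cong: "(\<And>i. i \<in> fv \<phi> \<Longrightarrow> s i = t i) \<Longrightarrow> sat A s \<phi> \<longleftrightarrow> sat A t \<phi>"
proof (induction \<phi> arbitrary: s t)
  case (Rel R xs)
  then have "map s xs = map t xs"
    by simp
  then show ?case
    by (simp only: sat.simps)
next
  case (Neg \<phi>)
  have "sat A s \<phi> \<longleftrightarrow> sat A t \<phi>"
    using Neg.prems by (intro Neg.IH) simp
  then show ?case
    by simp
next
  case (Conj \<phi> \<psi>)
  have "sat A s \<phi> \<longleftrightarrow> sat A t \<phi>" "sat A s \<psi> \<longleftrightarrow> sat A t \<psi>"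
    using Conj.prems by (intro Conj.IH; simp)+
  then show ?case
    by simp
next
  case (Ex x \<phi>)
  have "sat A (s(x := a)) \<phi> \<longleftrightarrow> sat A (t(x := a)) \<phi>" for a
    using Ex.prems by (intro Ex.IH) simp
  then show ?case
    by simp
next
  case (CEx j x \<phi>)
  have "sat A (s(x := a)) \<phi> \<longleftrightarrow> sat A (t(x := a)) \<phi>" for a
    using CEx.prems by (intro CEx.IH) simp
  then show ?case
    by simp
qed simp_all

lemma models_iff_sat:
  assumes "fv \<phi> = {}" "range s \<subseteq> univ A"
  shows "models A \<phi> \<longleftrightarrow> sat A s \<phi>"
proof -
  have "sat A s' \<phi> \<longleftrightarrow> sat A s \<phi>" for s'
    using assms(1) by (intro sat_cong) simp
  then show ?thesis
    using assms(2) unfolding models_def by blast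
qed

lemma finite_vars: "finite (vars \<phi>)"
  by (induction \<phi>) simp_all

lemma bij_betw_Collect_card_eq:
  assumes "bij_betw \<pi> A B" "\<And>a. a \<in> A \<Longrightarrow> P a \<longleftrightarrow> Q (\<pi> a)"
  shows "card {a \<in> A. P a} = card {b \<in> B. Q b}"
proof -
  have "\<pi> ` {a \<in> A. P a} = {b \<in> B. Q b}"
    using assms by (auto simp: bij_betw_def)
  then have "bij_betw \<pi> {a \<in> A. P a} {b \<in> B. Q b}"
    by (intro bij_betw_subset[OF assms(1)]) auto
  then show ?thesis
    by (rule bij_betw_same_card)
qed

text \<open>The bijective pebble game: \<open>similar r\<close> relates the positions from which Duplicator survives
  \<open>r\<close> further rounds with pebbles \<open>W\<close>.\<close>

lemma sat_iff_if_back_and_forth: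
  assumes Eq: "\<And>r s t x y. similar r s t \<Longrightarrow> x \<in> W \<Longrightarrow> y \<in> W \<Longrightarrow> s x = s y \<longleftrightarrow> t x = t y"
    and Rel: "\<And>r s t R xs. similar r s t \<Longrightarrow> set xs \<subseteq> W \<Longrightarrow> \<tau> R = Some (length xs) \<Longrightarrow>
      map s xs \<in> interp A R \<longleftrightarrow> map t xs \<in> interp B R"
    and forth: "\<And>r s t x. similar (Suc r) s t \<Longrightarrow> x \<in> W \<Longrightarrow>
      \<exists>\<pi>. bij_betw \<pi> (univ A) (univ B) \<and> (\<forall>a\<in>univ A. similar r (s(x := a)) (t(x := \<pi> a)))"
  shows "similar r s t \<Longrightarrow> vars \<phi> \<subseteq> W \<Longrightarrow> wf_fm \<tau> \<phi> \<Longrightarrow> qrank \<phi> \<le> r \<Longrightarrow> sat A s \<phi> \<longleftrightarrow> sat B t \<phi>"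
proof -
  have quantifier: "\<exists>\<pi>. bij_betw \<pi> (univ A) (univ B) \<and>
      (\<forall>a\<in>univ A. sat A (s(x := a)) \<phi> \<longleftrightarrow> sat B (t(x := \<pi> a)) \<phi>)"
    if IH: "\<And>r s t. similar r s t \<Longrightarrow> qrank \<phi> \<le> r \<Longrightarrow> sat A s \<phi> \<longleftrightarrow> sat B t \<phi>"
      and prems: "similar r s t" "x \<in> W" "Suc (qrank \<phi>) \<le> r" for x \<phi> r s t
  proof -
    obtain r' where r: "r = Suc r'" "qrank \<phi> \<le> r'"
      using prems(3) by (auto dest: Suc_le_D)
    then obtain \<pi> where "bij_betw \<pi> (univ A) (univ B)"
      and "\<forall>a\<in>univ A. similar r' (s(x := a)) (t(x := \<pi> a))"
      using forth prems(1,2) by blast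
    then show ?thesis
      using IH r(2) by blast
  qed
  show "similar r s t \<Longrightarrow> vars \<phi> \<subseteq> W \<Longrightarrow> wf_fm \<tau> \<phi> \<Longrightarrow> qrank \<phi> \<le> r \<Longrightarrow> sat A s \<phi> \<longleftrightarrow> sat B t \<phi>"
  proof (induction \<phi> arbitrary: r s t)
    case (Ex x \<phi>)
    then obtain \<pi> where \<pi>: "bij_betw \<pi> (univ A) (univ B)"
      and "\<forall>a\<in>univ A. sat A (s(x := a)) \<phi> \<longleftrightarrow> sat B (t(x := \<pi> a)) \<phi>"
      using quantifier[of \<phi> r s t x] by auto
    then have "(\<exists>a\<in>univ A. sat A (s(x := a)) \<phi>) \<longleftrightarrow> (\<exists>b\<in>\<pi> ` univ A. sat B (t(x := b)) \<phi>)"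
      by blast
    then show ?case
      by (simp add: bij_betw_imp_surj_on[OF \<pi>])
  next
    case (CEx j x \<phi>)
    then obtain \<pi> where "bij_betw \<pi> (univ A) (univ B)"
      and "\<forall>a\<in>univ A. sat A (s(x := a)) \<phi> \<longleftrightarrow> sat B (t(x := \<pi> a)) \<phi>"
      using quantifier[of \<phi> r s t x] by auto
    then have "card {a \<in> univ A. sat A (s(x := a)) \<phi>} = card {b \<in> univ B. sat B (t(x := b)) \<phi>}"
      by (intro bij_betw_Collect_card_eq) auto
    then show ?case
      by simp
  qed (use Eq Rel in auto)
qed

definition flip :: "bit \<Rightarrow> nat \<Rightarrow> nat" where
  "flip b a = 2 * (a div 2) + of_bool (odd a \<noteq> (b = 1))"

lemma flip_div_2 [simp]: "flip b a div 2 = a div 2"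
  by (simp add: flip_def)

lemma flip_0 [simp]: "flip 0 a = a"
  by (simp add: flip_def)

lemma flip_flip [simp]: "flip b (flip b a) = a"
  by (cases "b = 1") (simp_all add: flip_def)

lemma of_nat_flip: "(of_nat (flip b a) :: bit) = of_nat a + b"
  by (cases b) (simp_all add: flip_def of_nat_bit)

context compressed_computation
begin

definition similar :: "nat set \<Rightarrow> nat \<Rightarrow> (nat \<Rightarrow> nat) \<Rightarrow> (nat \<Rightarrow> nat) \<Rightarrow> bool" where
  "similar W r s t \<longleftrightarrow> (\<exists>g \<beta>. r * (d + 1) < g \<and> g < blk top \<and>
     consistent g ((\<lambda>i. s i div 2) ` W) \<beta> \<and> (\<forall>i\<in>W. s i < n \<and> t i = flip (\<beta> (s i div 2)) (s i)))"

lemma similar_Eq: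
  assumes "similar W r s t" "x \<in> W" "y \<in> W"
  shows "s x = s y \<longleftrightarrow> t x = t y"
proof -
  obtain \<beta> where \<beta>: "t x = flip (\<beta> (s x div 2)) (s x)" "t y = flip (\<beta> (s y div 2)) (s y)"
    using assms by (auto simp: similar_def)
  have "s x = s y" if "t x = t y"
  proof -
    have "s x div 2 = s y div 2"
      using arg_cong[OF that, of "\<lambda>a. a div 2"] \<beta> by simp
    then show ?thesis
      using \<beta> that flip_flip by metis
  qed
  then show ?thesis
    using \<beta> by auto
qed

lemma similar_Rel:
  assumes "similar W r s t" "set xs \<subseteq> W" "vocabulary R = Some (length xs)"
  shows "map s xs \<in> interp (xor_structure 0) R \<longleftrightarrow> map t xs \<in> interp (xor_structure 1) R"
proof -
  obtain e where e: "e \<in> equations" "R = to_nat e"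
    using assms(3) by (rule vocabulary_eq_SomeE)
  obtain g \<beta> where "r * (d + 1) < g" and g_top: "g < blk top"
    and consistent: "consistent g ((\<lambda>i. s i div 2) ` W) \<beta>"
    and t: "\<forall>i\<in>W. s i < n \<and> t i = flip (\<beta> (s i div 2)) (s i)"
    using assms(1) unfolding similar_def by blast
  then have g: "1 \<le> g"
    by simp
  have t_div: "map (\<lambda>i. t i div 2) xs = map (\<lambda>i. s i div 2) xs"
    using assms(2) t by auto
  have t_sum: "(\<Sum>i\<leftarrow>xs. of_nat (t i)) = (\<Sum>i\<leftarrow>xs. of_nat (s i)) + (\<Sum>i\<leftarrow>xs. \<beta> (s i div 2))"
  proof -
    have "(\<Sum>i\<leftarrow>xs. of_nat (t i)) = (\<Sum>i\<leftarrow>xs. of_nat (s i) + \<beta> (s i div 2))"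
      using assms(2) t by (intro arg_cong[where f = sum_list] map_cong) (auto simp: of_nat_flip)
    then show ?thesis
      by (simp only: sum_list_addf)
  qed
  show ?thesis
  proof (cases "map (\<lambda>i. s i div 2) xs = scope e")
    case True
    have "set (scope e) \<subseteq> (\<lambda>i. s i div 2) ` W"
      using assms(2) by (auto simp flip: True)
    then have "(\<Sum>v\<leftarrow>scope e. \<beta> v) = of_bool (e = None)"
      by (rule consistent_equation[OF consistent g g_top e(1)])
    then have "(\<Sum>i\<leftarrow>xs. \<beta> (s i div 2)) = of_bool (e = None)"
      by (simp flip: True add: o_def)
    then show ?thesis
      unfolding e(2) in_interp_xor_structure_iff map_map o_def t_div t_sum
      by (cases "\<Sum>i\<leftarrow>xs. of_nat (s i) :: bit") simp_all
  next
    case False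
    then show ?thesis
      unfolding e(2) in_interp_xor_structure_iff map_map o_def t_div by simp
  qed
qed

lemma flip_less:
  assumes "consistent g Q \<beta>" "a < n"
  shows "flip (\<beta> (a div 2)) a < n"
proof (cases "a div 2 < n div 2")
  case True
  then have "flip (\<beta> (a div 2)) a div 2 < n div 2"
    by simp
  then show ?thesis
    by linarith
next
  case False
  then show ?thesis
    using assms by (simp add: consistent_def)
qed

lemma similar_fun_upd:
  fixes a :: nat
  assumes "x \<in> W" "a < n" "r * (d + 1) < g" "g < blk top"
    and flipped: "\<And>i. i \<in> W \<Longrightarrow> s i < n \<and> t i = flip (\<beta> (s i div 2)) (s i)"
    and consistent:
      "consistent g (insert (a div 2) ((\<lambda>i. s i div 2) ` (W - {x}))) (\<beta>(a div 2 := b))"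
    and b: "a div 2 \<in> (\<lambda>i. s i div 2) ` (W - {x}) \<Longrightarrow> b = \<beta> (a div 2)"
  shows "similar W r (s(x := a)) (t(x := flip b a))"
proof -
  let ?Q = "(\<lambda>i. s i div 2) ` (W - {x})" and ?s = "s(x := a)" and ?\<beta> = "\<beta>(a div 2 := b)"
  have "(\<lambda>i. ?s i div 2) ` W = insert (?s x div 2) ((\<lambda>i. ?s i div 2) ` (W - {x}))"
    using assms(1) by blast
  also have "\<dots> = insert (a div 2) ?Q"
    by (intro arg_cong2[where f = insert] image_cong) simp_all
  finally have Q: "(\<lambda>i. ?s i div 2) ` W = insert (a div 2) ?Q" .
  have "(t(x := flip b a)) i = flip (?\<beta> (?s i div 2)) (?s i)" if "i \<in> W" for i
  proof (cases "i = x")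
    case False
    then have "s i div 2 \<in> ?Q"
      using that by blast
    then have "?\<beta> (s i div 2) = \<beta> (s i div 2)"
      using b by auto
    then show ?thesis
      using False flipped that by simp
  qed simp
  then show ?thesis
    unfolding similar_def Q using assms(2-4) consistent flipped
    by (intro exI[of _ g] exI[of _ ?\<beta>]) auto
qed

text \<open>The answer of Duplicator depends only on the variable \<open>a div 2\<close>, so that it is an involution.\<close>

lemma similar_forth:
  assumes W: "finite W" "card W \<le> d" "x \<in> W" and similar: "similar W (Suc r) s t"
  shows "\<exists>\<pi>. bij_betw \<pi> {..<n} {..<n} \<and> (\<forall>a\<in>{..<n}. similar W r (s(x := a)) (t(x := \<pi> a)))"
proof -
  let ?Q = "(\<lambda>i. s i div 2) ` (W - {x})"
  obtain g \<beta> where g: "Suc r * (d + 1) < g" "g < blk top"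
    and "consistent g ((\<lambda>i. s i div 2) ` W) \<beta>"
    and flipped: "\<And>i. i \<in> W \<Longrightarrow> s i < n \<and> t i = flip (\<beta> (s i div 2)) (s i)"
    using similar by (auto simp: similar_def)
  then have consistent: "consistent g ?Q \<beta>"
    by (elim consistent_antimono) auto
  have Q: "finite ?Q" "d + 1 \<le> g"
    using W(1) g(1) by simp_all
  have "card ?Q \<le> card (W - {x})"
    using W(1) by (intro card_image_le) simp
  then have "card (insert v ?Q) \<le> d" for v
    using Q(1) W card_Suc_Diff1[OF W(1,3)] by (simp add: card_insert_if)
  then have "\<exists>b g'. g \<le> g' + (d + 1) \<and> g' < g \<and> consistent g' (insert v ?Q) (\<beta>(v := b)) \<and>
      (v \<in> ?Q \<longrightarrow> b = \<beta> v)" for v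
    using consistent_extend[OF consistent Q(1) _ Q(2) g(2)] by metis
  then obtain b G where G: "\<And>v. g \<le> G v + (d + 1) \<and> G v < g"
    and extend: "\<And>v. consistent (G v) (insert v ?Q) (\<beta>(v := b v))"
    and b: "\<And>v. v \<in> ?Q \<Longrightarrow> b v = \<beta> v"
    by metis
  define \<pi> where "\<pi> a = flip (b (a div 2)) a" for a
  have "\<pi> (\<pi> a) = a" for a
    by (simp add: \<pi>_def)
  moreover have "\<pi> a < n" if "a < n" for a
    using flip_less[OF extend that, of "a div 2"] by (simp add: \<pi>_def)
  ultimately have "bij_betw \<pi> {..<n} {..<n}"
    by (intro bij_betwI[where g = \<pi>]) auto
  moreover have "similar W r (s(x := a)) (t(x := \<pi> a))" if "a < n" for a
    unfolding \<pi>_def using G[of "a div 2"] g flipped that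
    by (intro similar_fun_upd[OF W(3) _ _ _ _ extend b]) auto
  ultimately show ?thesis
    by blast
qed

lemma indistinguishable:
  assumes wf: "wf_fm vocabulary \<psi>" and fv: "fv \<psi> = {}" and vars: "card (vars \<psi>) \<le> d"
    and rank: "(qrank \<psi> + 1) * (d + 1) + 1 < blk top"
  shows "models (xor_structure 0) \<psi> \<longleftrightarrow> models (xor_structure 1) \<psi>"
proof -
  let ?s = "\<lambda>_::nat. 0::nat"
  let ?g = "(qrank \<psi> + 1) * (d + 1) + 1"
  have "card {0::nat} \<le> d" "d + 1 \<le> ?g"
    using d by simp_all
  then obtain b g where g: "?g \<le> g + (d + 1)" "g < ?g"
    and consistent: "consistent g {0} ((\<lambda>_. 0)(0 := b))"
    using consistent_extend[OF consistent_empty finite.emptyI _ _ rank] by metis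
  let ?t = "\<lambda>_::nat. flip b 0"
  have "consistent g ((\<lambda>i. ?s i div 2) ` vars \<psi>) ((\<lambda>_. 0)(0 := b))"
    by (rule consistent_antimono[OF consistent]) auto
  then have "similar (vars \<psi>) (qrank \<psi>) ?s ?t"
    unfolding similar_def using g rank n_pos
    by (intro exI[of _ g] exI[of _ "(\<lambda>_. 0)(0 := b)"]) simp
  then have "sat (xor_structure 0) ?s \<psi> \<longleftrightarrow> sat (xor_structure 1) ?t \<psi>"
    using similar_forth[OF finite_vars vars] wf
    by (intro sat_iff_if_back_and_forth[where similar = "similar (vars \<psi>)" and W = "vars \<psi>",
          OF similar_Eq similar_Rel]) auto
  also have "\<dots> \<longleftrightarrow> sat (xor_structure 1) ?s \<psi>"
    using fv by (intro sat_cong) simp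
  finally show ?thesis
    using n_pos models_iff_sat[OF fv, of ?s] by (simp add: image_subset_iff)
qed

end

section \<open>The distinguishing sentence\<close>

lemma foldr_Ex_simps [simp]:
  "wf_fm \<tau> (foldr Ex xs \<phi>) \<longleftrightarrow> wf_fm \<tau> \<phi>" "is_FO (foldr Ex xs \<phi>) \<longleftrightarrow> is_FO \<phi>"
  "vars (foldr Ex xs \<phi>) = set xs \<union> vars \<phi>" "fv (foldr Ex xs \<phi>) = fv \<phi> - set xs"
  by (induction xs) auto

lemma foldr_Conj_simps [simp]:
  "wf_fm \<tau> (foldr Conj \<phi>s \<chi>) \<longleftrightarrow> (\<forall>\<phi>\<in>set \<phi>s. wf_fm \<tau> \<phi>) \<and> wf_fm \<tau> \<chi>"
  "is_FO (foldr Conj \<phi>s \<chi>) \<longleftrightarrow> (\<forall>\<phi>\<in>set \<phi>s. is_FO \<phi>) \<and> is_FO \<chi>"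
  "vars (foldr Conj \<phi>s \<chi>) = (\<Union>\<phi>\<in>set \<phi>s. vars \<phi>) \<union> vars \<chi>"
  "fv (foldr Conj \<phi>s \<chi>) = (\<Union>\<phi>\<in>set \<phi>s. fv \<phi>) \<union> fv \<chi>"
  "sat A s (foldr Conj \<phi>s \<chi>) \<longleftrightarrow> (\<forall>\<phi>\<in>set \<phi>s. sat A s \<phi>) \<and> sat A s \<chi>"
  by (induction \<phi>s) auto

lemma sat_foldr_Ex:
  "sat A s (foldr Ex xs \<phi>) \<longleftrightarrow>
     (\<exists>t. (\<forall>i\<in>set xs. t i \<in> univ A) \<and> (\<forall>i. i \<notin> set xs \<longrightarrow> t i = s i) \<and> sat A t \<phi>)"
proof (induction xs arbitrary: s)
  case Nil
  have "t = s" if "\<forall>i. t i = s i" for t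
    using that by blast
  then show ?case
    by auto
next
  case (Cons x xs)
  show ?case (is "?L \<longleftrightarrow> ?R")
  proof
    assume ?L
    then obtain a t where "a \<in> univ A" "\<forall>i\<in>set xs. t i \<in> univ A"
      "\<forall>i. i \<notin> set xs \<longrightarrow> t i = (s(x := a)) i" "sat A t \<phi>"
      using Cons.IH by auto
    then show ?R
      by (intro exI[of _ t]) (cases "x \<in> set xs"; auto)
  next
    assume ?R
    then obtain t where t: "\<forall>i\<in>set (x # xs). t i \<in> univ A" "\<forall>i. i \<notin> set (x # xs) \<longrightarrow> t i = s i"
      "sat A t \<phi>"
      by blast
    then have "sat A (s(x := t x)) (foldr Ex xs \<phi>)"
      unfolding Cons.IH by (intro exI[of _ t]) auto
    then show ?L
      using t(1) by auto
  qed
qed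

context compressed_computation
begin

definition var_block :: "nat \<Rightarrow> nat list" where
  "var_block b = [b * D..<b * D + D]"

definition zero_tuple :: "'v \<Rightarrow> nat list \<Rightarrow> bool" where
  "zero_tuple u as \<longleftrightarrow> map (\<lambda>a. a div 2) as = inputs u \<and> (\<Sum>a\<leftarrow>as. of_nat a) = (0::bit)"

definition zero_formula :: "nat fm \<Rightarrow> 'v \<Rightarrow> nat \<Rightarrow> bool" where
  "zero_formula \<phi> u b \<longleftrightarrow> wf_fm vocabulary \<phi> \<and> is_FO \<phi> \<and> vars \<phi> \<subseteq> {..<3 * D} \<and>
     fv \<phi> \<subseteq> set (var_block b) \<and>
     (\<forall>c s. sat (xor_structure c) s \<phi> \<longleftrightarrow> zero_tuple u (map s (var_block b)))"

definition guarded :: "('v \<Rightarrow> nat \<Rightarrow> nat fm) \<Rightarrow> ('v \<times> nat) list \<Rightarrow> nat fm \<Rightarrow> nat fm" where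
  "guarded \<Phi> qs \<chi> =
     foldr Ex (concat (map (\<lambda>(p, b). var_block b) qs)) (foldr Conj (map (\<lambda>(p, b). \<Phi> p b) qs) \<chi>)"

lemma length_var_block [simp]: "length (var_block b) = D"
  by (simp add: var_block_def)

lemma in_var_block_iff [simp]: "i \<in> set (var_block b) \<longleftrightarrow> i div D = b"
proof
  assume "i \<in> set (var_block b)"
  then show "i div D = b"
    by (intro div_nat_eqI) (simp_all add: var_block_def mult.commute)
next
  assume "i div D = b"
  then show "i \<in> set (var_block b)"
    using D div_times_less_eq_dividend[of i D] dividend_less_div_times[of D i]
    by (auto simp: var_block_def add.commute)
qed

lemma set_concat_var_blocks:
  "set (concat (map (\<lambda>(p, b). var_block b) qs)) = {i. i div D \<in> snd ` set qs}"
  by (force simp: image_iff)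

lemma set_var_block_subset:
  assumes "b < 3"
  shows "set (var_block b) \<subseteq> {..<3 * D}"
proof
  fix i assume "i \<in> set (var_block b)"
  then show "i \<in> {..<3 * D}"
    using assms D by (auto simp: div_less_iff_less_mult)
qed

lemma zero_tuple_less: "u \<in> U \<Longrightarrow> zero_tuple u as \<Longrightarrow> a \<in> set as \<Longrightarrow> a < n"
proof -
  assume u: "u \<in> U" and "zero_tuple u as" "a \<in> set as"
  then have "a div 2 \<in> set (inputs u)"
    by (metis zero_tuple_def image_eqI list.set_map)
  then have "a div 2 < n div 2"
    using \<gamma>_less[OF u] by (auto simp: inputs_def)
  then show "a < n"
    by linarith
qed

lemma concat_zero_tuples:
  assumes "\<forall>(p, b)\<in>set qs. zero_tuple p (f b)"
  shows "map (\<lambda>a. a div 2) (concat (map (\<lambda>(p, b). f b) qs)) = concat (map (\<lambda>(p, b). inputs p) qs)"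
    and "(\<Sum>a\<leftarrow>concat (map (\<lambda>(p, b). f b) qs). of_nat a) = (0::bit)"
  using assms by (induction qs) (auto simp: zero_tuple_def)

lemma fresh_zero_tuples_exist:
  assumes "distinct (map snd qs)"
  obtains t where "\<forall>i. i div D \<notin> snd ` set qs \<longrightarrow> t i = s i"
    and "\<forall>(p, b)\<in>set qs. zero_tuple p (map t (var_block b))"
proof
  define t where "t i =
    (case map_of (map prod.swap qs) (i div D) of None \<Rightarrow> s i | Some p \<Rightarrow> 2 * \<gamma> p (i mod D))" for i
  have keys: "fst ` set (map prod.swap qs) = snd ` set qs"
    by (force simp: image_iff)
  have "map_of (map prod.swap qs) b = None" if "b \<notin> snd ` set qs" for b
    using that keys map_of_eq_None_iff[of "map prod.swap qs" b] by simp
  then show "\<forall>i. i div D \<notin> snd ` set qs \<longrightarrow> t i = s i"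
    by (simp add: t_def)
  show "\<forall>(p, b)\<in>set qs. zero_tuple p (map t (var_block b))"
  proof clarify
    fix p b assume "(p, b) \<in> set qs"
    then have "map_of (map prod.swap qs) b = Some p"
      using assms by (intro map_of_is_SomeI) (force simp: o_def image_iff)+
    then have "t i = 2 * \<gamma> p (i mod D)" if "i \<in> set (var_block b)" for i
      using that by (simp add: t_def)
    then have "map t (var_block b) = map (\<lambda>i. 2 * \<gamma> p (i mod D)) (var_block b)"
      by simp
    moreover have "map (\<lambda>i. \<gamma> p (i mod D)) (var_block b) = inputs p"
      by (rule nth_equalityI) (simp_all add: var_block_def inputs_def)
    then have "zero_tuple p (map (\<lambda>i. 2 * \<gamma> p (i mod D)) (var_block b))"
      by (simp add: zero_tuple_def o_def)
    ultimately show "zero_tuple p (map t (var_block b))"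
      by (simp only:)
  qed
qed

text \<open>A guarded formula relativizes its block variables to tuples that exist, so that it is
  equivalent to its kernel as soon as the latter does not depend on the choice of the tuples.\<close>

lemma sat_guarded_iff:
  assumes distinct: "distinct (map snd qs)"
    and \<Phi>: "\<And>p b. (p, b) \<in> set qs \<Longrightarrow> p \<in> U \<and> zero_formula (\<Phi> p b) p b"
    and kernel: "\<And>t. \<forall>i. i div D \<notin> snd ` set qs \<longrightarrow> t i = s i \<Longrightarrow>
      \<forall>(p, b)\<in>set qs. zero_tuple p (map t (var_block b)) \<Longrightarrow> sat (xor_structure c) t \<chi> \<longleftrightarrow> P"
  shows "sat (xor_structure c) s (guarded \<Phi> qs \<chi>) \<longleftrightarrow> P"
proof -
  define V where "V = {i. i div D \<in> snd ` set qs}"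
  define zero where "zero t \<longleftrightarrow> (\<forall>(p, b)\<in>set qs. zero_tuple p (map t (var_block b)))" for t
  obtain t\<^sub>0 where fresh: "\<forall>i. i \<notin> V \<longrightarrow> t\<^sub>0 i = s i" "zero t\<^sub>0"
    unfolding V_def zero_def mem_Collect_eq by (rule fresh_zero_tuples_exist[OF distinct])
  have guards: "(\<forall>\<phi>\<in>set (map (\<lambda>(p, b). \<Phi> p b) qs). sat (xor_structure c) t \<phi>) \<longleftrightarrow> zero t" for t
    using \<Phi> by (force simp: zero_formula_def zero_def)
  have range: "t i \<in> {..<n}" if t: "zero t" and i: "i \<in> V" for t i
  proof -
    obtain p where p: "(p, i div D) \<in> set qs"
      using i by (force simp: V_def)
    then have "zero_tuple p (map t (var_block (i div D)))"
      using t by (auto simp: zero_def)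
    moreover have "t i \<in> set (map t (var_block (i div D)))"
      by simp
    ultimately show ?thesis
      using \<Phi>[OF p] zero_tuple_less by blast
  qed
  have "sat (xor_structure c) s (guarded \<Phi> qs \<chi>) \<longleftrightarrow> (\<exists>t. (\<forall>i\<in>V. t i \<in> {..<n}) \<and>
      (\<forall>i. i \<notin> V \<longrightarrow> t i = s i) \<and> zero t \<and> sat (xor_structure c) t \<chi>)"
    unfolding guarded_def sat_foldr_Ex foldr_Conj_simps guards set_concat_var_blocks
      univ_xor_structure V_def ..
  also have "\<dots> \<longleftrightarrow> (\<exists>t. (\<forall>i. i \<notin> V \<longrightarrow> t i = s i) \<and> zero t \<and> sat (xor_structure c) t \<chi>)"
    using range by blast
  also have "\<dots> \<longleftrightarrow> (\<exists>t. (\<forall>i. i \<notin> V \<longrightarrow> t i = s i) \<and> zero t \<and> P)"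
    using kernel by (simp add: V_def zero_def cong: conj_cong)
  also have "\<dots> \<longleftrightarrow> P"
    using fresh by blast
  finally show ?thesis .
qed

lemma guarded_syntax:
  assumes "\<And>p b. (p, b) \<in> set qs \<Longrightarrow> b < 3 \<and> zero_formula (\<Phi> p b) p b"
  shows "wf_fm vocabulary (guarded \<Phi> qs \<chi>) \<longleftrightarrow> wf_fm vocabulary \<chi>"
    and "is_FO (guarded \<Phi> qs \<chi>) \<longleftrightarrow> is_FO \<chi>"
    and "vars \<chi> \<subseteq> {..<3 * D} \<Longrightarrow> vars (guarded \<Phi> qs \<chi>) \<subseteq> {..<3 * D}"
    and "fv (guarded \<Phi> qs \<chi>) \<subseteq> {i \<in> fv \<chi>. i div D \<notin> snd ` set qs}"
proof -
  show "wf_fm vocabulary (guarded \<Phi> qs \<chi>) \<longleftrightarrow> wf_fm vocabulary \<chi>"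
    "is_FO (guarded \<Phi> qs \<chi>) \<longleftrightarrow> is_FO \<chi>"
    using assms by (auto simp: guarded_def zero_formula_def)
  show "vars (guarded \<Phi> qs \<chi>) \<subseteq> {..<3 * D}" if "vars \<chi> \<subseteq> {..<3 * D}"
  proof -
    have "set (var_block b) \<union> vars (\<Phi> p b) \<subseteq> {..<3 * D}" if "(p, b) \<in> set qs" for p b
      using assms[OF that] set_var_block_subset[of b] by (simp add: zero_formula_def)
    then show ?thesis
      using that by (auto simp: guarded_def simp del: in_var_block_iff)
  qed
  have "fv (\<Phi> p b) \<subseteq> {i. i div D \<in> snd ` set qs}" if "(p, b) \<in> set qs" for p b
    using assms[OF that] that by (force simp: zero_formula_def)
  then show "fv (guarded \<Phi> qs \<chi>) \<subseteq> {i \<in> fv \<chi>. i div D \<notin> snd ` set qs}"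
    by (auto simp: guarded_def set_concat_var_blocks simp del: set_concat)
qed

lemma zero_formula_guarded:
  assumes u: "u \<in> U" "b < 3" and fst_qs: "map fst qs = preds u"
    and snd_qs: "distinct (map snd qs)" "b \<notin> snd ` set qs"
    and \<Phi>: "\<And>p b'. (p, b') \<in> set qs \<Longrightarrow> b' < 3 \<and> zero_formula (\<Phi> p b') p b'"
  defines "\<chi> \<equiv> Rel (to_nat (Some u)) (var_block b @ concat (map (\<lambda>(p, b). var_block b) qs))"
  shows "zero_formula (guarded \<Phi> qs \<chi>) u b"
proof -
  have p: "p \<in> U" if "(p, b') \<in> set qs" for p b'
  proof -
    have "p \<in> set (preds u)"
      using that by (force simp flip: fst_qs)
    then show ?thesis
      using preds_subset[OF u(1)] by blast
  qed
  have scope: "scope (Some u) = inputs u @ concat (map (\<lambda>(p, b). inputs p) qs)"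
    by (simp add: scope_def split_def o_def flip: fst_qs)
  have "sat (xor_structure c) s (guarded \<Phi> qs \<chi>) \<longleftrightarrow> zero_tuple u (map s (var_block b))" for c s
  proof (rule sat_guarded_iff[OF snd_qs(1)])
    fix t assume t: "\<forall>i. i div D \<notin> snd ` set qs \<longrightarrow> t i = s i"
      "\<forall>(p, b)\<in>set qs. zero_tuple p (map t (var_block b))"
    have "sat (xor_structure c) t \<chi> \<longleftrightarrow> zero_tuple u (map t (var_block b))"
      using concat_zero_tuples[OF t(2)]
      by (simp add: \<chi>_def in_interp_xor_structure_iff scope zero_tuple_def map_concat
          split_def o_def)
    also have "map t (var_block b) = map s (var_block b)"
      using t(1) snd_qs(2) by auto
    finally show "sat (xor_structure c) t \<chi> \<longleftrightarrow> zero_tuple u (map s (var_block b))" .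
  qed (use p \<Phi> in blast)
  moreover have "wf_fm vocabulary \<chi>"
    using u(1)
    by (simp add: \<chi>_def vocabulary_to_nat equations_def scope length_concat split_def o_def)
  moreover have "set (var_block b') \<subseteq> {..<3 * D}" if "(p, b') \<in> set qs" for p b'
    using \<Phi>[OF that] by (intro set_var_block_subset) simp
  then have "vars \<chi> \<subseteq> {..<3 * D}"
    using set_var_block_subset[OF u(2)] by (auto simp: \<chi>_def simp del: in_var_block_iff)
  moreover have "{i \<in> fv \<chi>. i div D \<notin> snd ` set qs} \<subseteq> set (var_block b)"
    by (auto simp: \<chi>_def set_concat_var_blocks simp del: set_concat)
  ultimately show ?thesis
    using guarded_syntax[of qs \<Phi> \<chi>] \<Phi> by (simp add: zero_formula_def \<chi>_def)
qed

text \<open>Three blocks of variables suffice: the formula for a predecessor may reuse the block of the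
  value it is computed for.\<close>

lemma zero_formula_exists:
  assumes "u \<in> U" "b < 3"
  shows "\<exists>\<phi>. zero_formula \<phi> u b"
  using assms
proof (induction "depth u" arbitrary: u b rule: less_induct)
  case less
  have "\<exists>\<phi>. zero_formula \<phi> p b'" if "p \<in> set (preds u)" "b' < 3" for p b'
    using less.hyps preds_depth[OF less.prems(1) that(1)] preds_subset[OF less.prems(1)] that
    by blast
  then obtain \<Phi> where \<Phi>: "\<And>p b'. p \<in> set (preds u) \<Longrightarrow> b' < 3 \<Longrightarrow> zero_formula (\<Phi> p b') p b'"
    by metis
  define qs where "qs = zip (preds u) [(b + 1) mod 3, (b + 2) mod 3]"
  have "map fst qs = preds u"
    using preds_length[OF less.prems(1)] by (simp add: qs_def map_fst_zip_take)
  moreover have "b \<in> {0, 1, 2}"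
    using less.prems(2) by auto
  then have "distinct (map snd qs)" "b \<notin> snd ` set qs" "\<And>p b'. (p, b') \<in> set qs \<Longrightarrow> b' < 3"
    by (auto simp: qs_def map_snd_zip_take take_Cons split: nat.splits dest!: set_zip_rightD)
  moreover have "p \<in> set (preds u)" if "(p, b') \<in> set qs" for p b'
    using that unfolding qs_def by (rule set_zip_leftD)
  ultimately show ?case
    using zero_formula_guarded[OF less.prems] \<Phi> by blast
qed

lemma distinguishing_sentence_exists:
  assumes "3 * D \<le> k"
  shows "\<exists>\<phi>\<in>FO_sentences vocabulary k. models (xor_structure 0) \<phi> \<and> \<not> models (xor_structure 1) \<phi>"
proof -
  obtain \<phi> where \<phi>: "zero_formula \<phi> top 0"
    using zero_formula_exists[OF top_in_U] by fastforce
  let ?\<chi> = "Rel (to_nat (None :: 'v option)) (var_block 0)"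
  let ?\<psi> = "guarded (\<lambda>_ _. \<phi>) [(top, 0)] ?\<chi>"
  have sat: "sat (xor_structure c) s ?\<psi> \<longleftrightarrow> c = 0" for c s
    by (rule sat_guarded_iff)
      (use \<phi> top_in_U in \<open>auto simp: in_interp_xor_structure_iff zero_tuple_def scope_def o_def\<close>)
  have shape: "wf_fm vocabulary ?\<psi>" "is_FO ?\<psi>" "vars ?\<psi> \<subseteq> {..<3 * D}" "fv ?\<psi> = {}"
    using guarded_syntax[of "[(top, 0)]" "\<lambda>_ _. \<phi>" ?\<chi>] \<phi> set_var_block_subset[of 0]
    by (auto simp: vocabulary_to_nat equations_def length_scope)
  then have "card (vars ?\<psi>) \<le> k"
    using card_mono[OF _ shape(3)] assms by simp
  then have "?\<psi> \<in> FO_sentences vocabulary k"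
    using shape by (simp add: FO_sentences_def)
  moreover have "models (xor_structure c) ?\<psi> \<longleftrightarrow> c = 0" for c
    using models_iff_sat[OF shape(4), of "\<lambda>_. 0" "xor_structure c"] sat n_pos
    by (simp add: image_subset_iff)
  ultimately show ?thesis
    by (intro bexI[of _ ?\<psi>]) simp_all
qed

lemma xor_structures_separate:
  assumes arity: "3 * D \<le> k" and rank: "\<And>r. real r \<le> q \<Longrightarrow> (r + 1) * (d + 1) + 1 < blk top"
  shows "\<exists>(\<tau> :: nat vocabulary) (A :: (nat, nat) rel_structure) (B :: (nat, nat) rel_structure).
    kary_structure k \<tau> A \<and> kary_structure k \<tau> B \<and>
    card (univ A) = n \<and> card (univ B) = n \<and>
    (\<exists>\<phi> \<in> FO_sentences \<tau> k. models A \<phi> \<and> \<not> models B \<phi>) \<and>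
    (\<forall>\<psi> \<in> FO_sentences \<tau> d \<union> C_sentences \<tau> d.
       real (qrank \<psi>) \<le> q \<longrightarrow> (models A \<psi> \<longleftrightarrow> models B \<psi>))"
proof -
  have equivalent: "\<forall>\<psi> \<in> FO_sentences vocabulary d \<union> C_sentences vocabulary d.
      real (qrank \<psi>) \<le> q \<longrightarrow> (models (xor_structure 0) \<psi> \<longleftrightarrow> models (xor_structure 1) \<psi>)"
    using rank indistinguishable by (auto simp: FO_sentences_def C_sentences_def)
  show ?thesis
    by (rule exI[of _ vocabulary], rule exI[of _ "xor_structure 0"],
        rule exI[of _ "xor_structure 1"])
      (simp add: equivalent kary_xor_structure[OF arity] distinguishing_sentence_exists[OF arity])
qed

end

section \<open>Choice of parameters\<close>

lemma linear_computation_cells: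
  assumes T: "\<And>t. Suc t < h \<Longrightarrow> inj_linear w (T t)" and free: "coincidence_free h w d T"
    and "2 \<le> h" "1 \<le> w"
  shows "linear_computation (cells h w) (preds_of T w) fst (depth_of w) (form_from T 0)
    (h - 1, 0, w - 1) d"
proof
  show "set (preds_of T w u) \<subseteq> cells h w" if "u \<in> cells h w" for u
    using in_set_preds_ofD(1)[OF that] by blast
  show "depth_of w p < depth_of w u" "fst p = fst u \<or> Suc (fst p) = fst u"
    if "u \<in> cells h w" "p \<in> set (preds_of T w u)" for u p
    using in_set_preds_ofD[OF that] by blast+
  show "form_from T 0 u = sum (form_from T 0) (set (preds_of T w u))"
    if "u \<in> cells h w" "1 \<le> fst u" for u
    using form_from_eq_sum_preds[OF T that] .
  show "sum (form_from T 0) B = 0"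
    if "1 \<le> g" "A \<subseteq> cells h w" "B \<subseteq> cells h w" "\<And>u. u \<in> A \<Longrightarrow> fst u < g"
      "\<And>u. u \<in> B \<Longrightarrow> g < fst u" "card A \<le> d" "card B \<le> d + 1"
      "sum (form_from T 0) A = sum (form_from T 0) B" for g A B
    by (rule coincidence_freeD[OF free that(2,3,6,7), of "g - 1"]) (use that in force)+
  show "(h - 1, 0, w - 1) \<in> cells h w" "form_from T 0 (h - 1, 0, w - 1) \<noteq> 0"
    using assms form_from_last_nonzero[OF T] by (simp_all add: cells_def)
qed (simp_all add: distinct_preds_of length_preds_of finite_cells)

lemma compressed_computation_exists:
  assumes "1 \<le> e" "3 \<le> d" "2 \<le> h" "1 \<le> w" "2 \<le> n"
    and expander_bound:
      "Suc (2 * d) * card (cells h w) * (2 * e * (2 * d)) ^ (3 * e) \<le> (n div 2) ^ e"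
    and maps_bound: "Suc (h * card (cells h w) ^ (2 * d + 1)) < 2 ^ w"
  obtains \<gamma> preds blk depth and form :: "cell \<Rightarrow> bitvec" and top
  where "compressed_computation (cells h w) \<gamma> (3 * e) n d preds blk depth form top"
    and "blk top = h - 1"
proof -
  have "{..<n div 2} \<noteq> {}"
    using assms(5) by (auto simp: lessThan_empty_iff)
  then obtain \<gamma> where "\<And>u i. u \<in> cells h w \<Longrightarrow> i < 3 * e \<Longrightarrow> \<gamma> u i \<in> {..<n div 2}"
    and "unique_nbr_expander \<gamma> (3 * e) (cells h w) (2 * d)"
    using unique_nbr_expander_exists[OF finite_cells finite_lessThan assms(1)] expander_bound
    unfolding card_lessThan by metis
  then have compression: "xor_compression (cells h w) \<gamma> (3 * e) (n div 2) d"
    by unfold_locales (simp_all add: finite_cells)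
  obtain T where "\<And>t. Suc t < h \<Longrightarrow> inj_linear w (T t)" "coincidence_free h w d T"
    using coincidence_free_maps_exist[OF maps_bound] by blast
  then have "linear_computation (cells h w) (preds_of T w) fst (depth_of w) (form_from T 0)
      (h - 1, 0, w - 1) d"
    using assms(3,4) by (rule linear_computation_cells)
  with compression have "compressed_computation (cells h w) \<gamma> (3 * e) n d (preds_of T w) fst
      (depth_of w) (form_from T 0) (h - 1, 0, w - 1)"
    using assms(1,2) by (simp add: compressed_computation_def compressed_computation_axioms_def)
  then show thesis
    by (rule that) simp
qed

lemma mult_le_square_div_2:
  fixes n x :: nat
  assumes "2 \<le> n" "9 * x \<le> n"
  shows "n * x \<le> (n div 2) ^ 2"
proof -
  have "n \<le> 3 * (n div 2)"
    using assms(1) by linarith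
  have "n * (9 * x) \<le> n * n"
    using assms(2) by (rule mult_le_mono2)
  also have "\<dots> \<le> (3 * (n div 2)) * (3 * (n div 2))"
    using \<open>n \<le> 3 * (n div 2)\<close> by (intro mult_le_mono)
  finally show ?thesis
    by (simp add: power2_eq_square)
qed

lemma expander_bound:
  fixes c d k n :: nat
  assumes "1 \<le> c" "18 * c \<le> k" "1 \<le> d" "9 * d \<le> n" and n: "9 * (d * k) ^ 6 \<le> n"
  shows "Suc (2 * d) * n ^ (c - 1) * (2 * (2 * c) * (2 * d)) ^ (3 * (2 * c)) \<le> (n div 2) ^ (2 * c)"
proof -
  have "Suc (2 * d) * n ^ (c - 1) \<le> n * n ^ (c - 1)"
    using assms(3,4) by (intro mult_le_mono1) simp
  also have "\<dots> = n ^ c"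
    using assms(1) by (simp flip: power_Suc)
  finally have "Suc (2 * d) * n ^ (c - 1) \<le> n ^ c" .
  moreover have "(2 * (2 * c) * (2 * d)) ^ (3 * (2 * c)) \<le> (d * k) ^ (6 * c)"
  proof -
    have "d * (8 * c) \<le> d * k"
      using assms(2) by (intro mult_le_mono2) simp
    then have "(2 * (2 * c) * (2 * d)) ^ (6 * c) \<le> (d * k) ^ (6 * c)"
      by (intro power_mono) simp_all
    then show ?thesis
      by (simp add: mult.assoc[symmetric])
  qed
  ultimately have "Suc (2 * d) * n ^ (c - 1) * (2 * (2 * c) * (2 * d)) ^ (3 * (2 * c)) \<le>
      n ^ c * (d * k) ^ (6 * c)"
    by (rule mult_le_mono)
  also have "\<dots> = (n * (d * k) ^ 6) ^ c"
    by (simp only: power_mult_distrib power_mult)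
  also have "\<dots> \<le> ((n div 2) ^ 2) ^ c"
    using assms(3,4) n by (intro power_mono mult_le_square_div_2) simp_all
  finally show ?thesis
    by (simp only: power_mult)
qed

lemma Suc_power_less_two_power_cube:
  fixes n x :: nat
  assumes "2 \<le> n" "x < n ^ 2"
  shows "Suc (n ^ x) < 2 ^ (n ^ 3)"
proof -
  have "n ^ x \<le> (2 ^ n) ^ x"
    by (intro power_mono) (simp_all add: less_imp_le)
  moreover have "(1::nat) \<le> (2 ^ n) ^ x"
    by simp
  ultimately have "Suc (n ^ x) \<le> 2 * (2 ^ n) ^ x"
    by linarith
  also have "\<dots> = 2 ^ Suc (n * x)"
    by (simp add: power_mult)
  also have "\<dots> < 2 ^ (n ^ 3)"
  proof (rule power_strict_increasing)
    have "Suc (n * x) < n * Suc x"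
      using assms(1) by simp
    also have "\<dots> \<le> n * n ^ 2"
      using assms(2) by (intro mult_le_mono2) simp
    finally show "Suc (n * x) < n ^ 3"
      by (simp add: eval_nat_numeral)
  qed simp
  finally show ?thesis .
qed

lemma maps_bound:
  fixes c d n :: nat
  assumes "c \<le> d" "4 * d + 2 \<le> n"
  shows "Suc (n ^ (c - 7) * (n ^ (c - 1)) ^ (2 * d + 1)) < 2 ^ (n ^ 3)"
proof -
  have "c - 7 + (c - 1) * (2 * d + 1) \<le> d * (2 * d + 2)"
  proof -
    have "(c - 1) * (2 * d + 1) \<le> d * (2 * d + 1)"
      using assms(1) by (intro mult_le_mono1) simp
    then show ?thesis
      using assms(1) by simp
  qed
  also have "\<dots> \<le> (2 * d + 1) * (2 * d + 1)"
    by simp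
  also have "\<dots> < n * n"
    using assms(2) by (intro mult_strict_mono) simp_all
  finally have "Suc (n ^ (c - 7 + (c - 1) * (2 * d + 1))) < 2 ^ (n ^ 3)"
    using assms(2) by (intro Suc_power_less_two_power_cube) (simp_all add: power2_eq_square)
  then show ?thesis
    by (simp add: power_add power_mult)
qed

lemma rank_bound:
  fixes d k n r :: nat
  assumes k: "360 \<le> k" and n: "5 \<le> n" "4 * d \<le> n"
    and r: "real r \<le> real n powr (1 / 36 * real k)"
  shows "(r + 1) * (d + 1) + 1 < n ^ (k div 18 - 7) - 1"
proof -
  define N where "N = n ^ (k div 18 - 9)"
  have N_pos: "1 \<le> N"
    using n(1) by (simp add: N_def)
  have "real k / 36 \<le> real (k div 18 - 9)"
    using k by linarith
  then have "real n powr (1 / 36 * real k) \<le> real n powr real (k div 18 - 9)"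
    using n(1) by (intro powr_mono) simp_all
  also have "\<dots> = real N"
    using n(1) by (simp add: N_def powr_realpow)
  finally have "r \<le> N"
    using r by linarith
  then have "(r + 1) * (d + 1) \<le> (2 * N) * n"
    using N_pos n by (intro mult_le_mono) simp_all
  moreover have "5 * (N * n) \<le> n * (N * n)" "1 * 1 \<le> N * n"
    using n(1) N_pos by (intro mult_le_mono; simp)+
  moreover have "n ^ (k div 18 - 7) = n * (N * n)"
  proof -
    have "k div 18 - 7 = Suc (Suc (k div 18 - 9))"
      using k by linarith
    then show ?thesis
      by (simp add: N_def)
  qed
  ultimately show ?thesis
    by linarith
qed

lemma n_lower_bounds:
  fixes d k n :: nat
  assumes "1 \<le> d" "1 \<le> k" and n: "9 * real d ^ 8 * real k ^ 6 \<le> real n"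
  shows "9 * (d * k) ^ 6 \<le> n" "9 * d \<le> n"
proof -
  have "real (9 * d ^ 8 * k ^ 6) \<le> real n"
    using n by simp
  then have "9 * d ^ 8 * k ^ 6 \<le> n"
    unfolding of_nat_le_iff .
  moreover have "d ^ 6 * k ^ 6 \<le> d ^ 8 * k ^ 6"
    using assms(1) by (intro mult_le_mono1 power_increasing) simp_all
  ultimately have "9 * (d ^ 6 * k ^ 6) \<le> n"
    by linarith
  then show "9 * (d * k) ^ 6 \<le> n"
    by (simp add: power_mult_distrib)
  have "d * 1 \<le> d * k" "d * k \<le> (d * k) ^ 6"
    using assms(1,2) by (auto intro: self_le_power)
  then show "9 * d \<le> n"
    using \<open>9 * (d * k) ^ 6 \<le> n\<close> by linarith
qed

lemma hard_computation_exists: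
  fixes d k n :: nat
  assumes k: "360 \<le> k" "k \<le> d" and n: "9 * real d ^ 8 * real k ^ 6 \<le> real n"
  shows "\<exists>(U :: cell set) \<gamma> D preds blk depth (form :: _ \<Rightarrow> bitvec) top.
    compressed_computation U \<gamma> D n d preds blk depth form top \<and> 3 * D \<le> k \<and>
    (\<forall>r. real r \<le> real n powr (1 / 36 * real k) \<longrightarrow> (r + 1) * (d + 1) + 1 < blk top)"
proof -
  define c where "c = k div 18"
  define h where "h = n ^ (c - 7)"
  have c_bounds: "20 \<le> c" "18 * c \<le> k"
    using k(1) by (simp_all add: c_def)
  have n_bounds: "9 * (d * k) ^ 6 \<le> n" "9 * d \<le> n"
    using n_lower_bounds[OF _ _ n] k by simp_all
  have "card (cells h (n ^ 3)) = n ^ (c - 7 + 3 * 2)"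
    unfolding card_cells h_def by (simp only: power_add power_mult)
  also have "c - 7 + 3 * 2 = c - 1"
    using c_bounds(1) by simp
  finally have card: "card (cells h (n ^ 3)) = n ^ (c - 1)" .
  have "1 \<le> 2 * c" "3 \<le> d"
    using c_bounds(1) k by simp_all
  moreover have "2 \<le> h"
    using self_le_power[of n "c - 7"] c_bounds(1) n_bounds(2) k by (simp add: h_def)
  moreover have "1 \<le> n ^ 3" "2 \<le> n"
    using n_bounds(2) k by simp_all
  moreover have "Suc (2 * d) * card (cells h (n ^ 3)) * (2 * (2 * c) * (2 * d)) ^ (3 * (2 * c))
      \<le> (n div 2) ^ (2 * c)"
    unfolding card using c_bounds n_bounds k by (intro expander_bound) simp_all
  moreover have "Suc (h * card (cells h (n ^ 3)) ^ (2 * d + 1)) < 2 ^ (n ^ 3)"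
    unfolding card unfolding h_def using c_bounds(2) n_bounds(2) k by (intro maps_bound) simp_all
  ultimately obtain \<gamma> preds blk depth and form :: "cell \<Rightarrow> bitvec" and top
    where "compressed_computation (cells h (n ^ 3)) \<gamma> (3 * (2 * c)) n d preds blk depth form top"
      and "blk top = h - 1"
    by (rule compressed_computation_exists)
  moreover have "(r + 1) * (d + 1) + 1 < h - 1" if "real r \<le> real n powr (1 / 36 * real k)" for r
    unfolding h_def c_def using n_bounds(2) k that by (intro rank_bound) simp_all
  moreover have "3 * (3 * (2 * c)) \<le> k"
    using c_bounds(2) by simp
  ultimately show ?thesis
    by metis
qed

theorem theorem1p5:
  "\<exists>(k0::nat) (\<alpha>::real) (\<epsilon>::real). \<alpha> > 0 \<and> \<epsilon> > 0 \<and>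
     (\<forall>(d::nat) (k::nat) (n::nat).
        d \<ge> k \<longrightarrow> k \<ge> k0 \<longrightarrow> real n \<ge> \<alpha> * real d ^ 8 * real k ^ 6 \<longrightarrow>
        (\<exists>(\<tau> :: nat vocabulary) (A :: (nat, nat) rel_structure) (B :: (nat, nat) rel_structure).
           kary_structure k \<tau> A \<and> kary_structure k \<tau> B \<and>
           card (univ A) = n \<and> card (univ B) = n \<and>
           (\<exists>\<phi> \<in> FO_sentences \<tau> k. models A \<phi> \<and> \<not> models B \<phi>) \<and>
           (\<forall>\<psi> \<in> FO_sentences \<tau> d \<union> C_sentences \<tau> d.
              real (qrank \<psi>) \<le> real n powr (\<epsilon> * real k) \<longrightarrow>
              (models A \<psi> \<longleftrightarrow> models B \<psi>))))"
proof (rule exI[of _ 360], rule exI[of _ 9], rule exI[of _ "1 / 36"],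
    intro conjI allI impI, goal_cases)
  case (3 d k n)
  then obtain U :: "cell set" and \<gamma> D preds blk depth and form :: "_ \<Rightarrow> bitvec" and top
    where computation: "compressed_computation U \<gamma> D n d preds blk depth form top"
      and arity: "3 * D \<le> k"
      and rank: "\<forall>r. real r \<le> real n powr (1 / 36 * real k) \<longrightarrow> (r + 1) * (d + 1) + 1 < blk top"
    using hard_computation_exists[of k d n] by blast
  interpret compressed_computation U \<gamma> D n d preds blk depth form top
    by (rule computation)
  show ?case
    using rank by (intro xor_structures_separate arity) blast
qed simp_all

end
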